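(* Assume that there exist constants $C,\lambda>0$ and $\zeta\in(0,1]$, $\sigma_\epsilon$-invariant measurable sets $\Omega_\epsilon\subset\Omega$, $\epsilon\in I$, with $\mathbb P_\epsilon(\Omega_\epsilon)=1$, and for each $\epsilon\in I$ a family $(h_{\omega,\epsilon})_{\omega\in\Omega_\epsilon}\subset\mathcal B_s$ (with $h_\omega:=h_{\omega,0}$) such that: (A1) $\|\mathcal L_{\omega,\epsilon}^n h\|_w\le Ce^{-\lambda n}\|h\|_w$ for all $h\in\mathcal B_w$ with $\psi(h)=0$, $n\in\mathbb N$, $\epsilon\in I$, $\omega\in\Omega_\epsilon$; (A2) $\|\mathcal L_{\omega,\epsilon}h-\mathcal L_{\omega'}h\|_w\le C\left(d(\omega,\omega')^\zeta+|\epsilon|^\zeta\right)\|h\|_s$ for all $\epsilon\in I$, $h\in\mathcal B_s$, $\omega\in\Omega_\epsilon$, $\omega'\in\Omega_0$; (A3) $\psi(h_{\omega,\epsilon})=1$ and $\|h_{\omega,\epsilon}\|_s\le C$ for all $\epsilon\in I$, $\omega\in\Omega_\epsilon$; (A4) $\mathcal L_{\omega,\epsilon}h_{\omega,\epsilon}=h_{\sigma_\epsilon\omega,\epsilon}$ for all $\epsilon\in I$, $\omega\in\Omega_\epsilon$; (A5) $\sigma^{-1}$ is Lipschitz continuous; (B1) there is $K>0$ such that $\sup_j\|\mathcal L_\omega^j\|_s\le K$ for every $\omega\in\Omega_0$ (operator norm on $\mathcal B_s$); (B2) $h_\omega\in\mathcal B_{ss}$ and $\|h_\omega\|_{ss}\le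 C$ for every $\omega\in\Omega_0$; (B3) for every function $\gamma:I\to\Omega$ differentiable at $\epsilon=0$ there exists a bounded operator $\frac{\partial\mathcal L_{\gamma(\epsilon),\epsilon}}{\partial\epsilon}\Big|_{\epsilon=0}:\mathcal B_{ss}\to\mathcal B_s^0$ such that for all $g\in\mathcal B_{ss}$ and $\epsilon\in I$, $$\left\|(\mathcal L_{\gamma(\epsilon),\epsilon}-\mathcal L_{\gamma(0),0})g-\epsilon\left(\frac{\partial\mathcal L_{\gamma(\epsilon),\epsilon}}{\partial\epsilon}\Big|_{\epsilon=0}\right)g\right\|_s\le C\left(|\epsilon|^{1+\zeta}+d(\gamma(\epsilon),\gamma(0))^{1+\zeta}\right)\|g\|_{ss};$$ (B4) the maps $\epsilon\mapsto\sigma_\epsilon^{-k}\omega$ are differentiable at $\epsilon=0$, and $\mathrm{Lip}(\sigma^{-k})\le Ce^{ck}$ for all $k\in\mathbb N$ and some $c<\lambda/(1+\zeta)$; (B5) $\mathrm{dist}_{C^0}(\sigma^{-1},\sigma_\epsilon^{-1})=O(\epsilon)$; (B6) with $\Lambda_{\omega,j}:=\frac{\partial\mathcal L_{\sigma_\epsilon^{-(j+1)}\omega,\epsilon}}{\partial\epsilon}\Big|_{\epsilon=0}$, one has $\sup_{\omega,j}\|\Lambda_{\omega,j}\|<+\infty$ (norm of operators $\mathcal B_{ss}\to\mathcal B_s$; $\omega\in\Omega$, $j\ge0$); (C1) there is a measurable set $\Omega'$ such that $\Omega'\subset\Omega_\epsilon$ and $\mathbb P_\epsilon(\Omega')=1$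 for every $\epsilon\in I$; (C2) the $h_{\omega,\epsilon}$ are Borel probability measures on $M$ (in case (H)), respectively probability densities with respect to $m$ (in case (E)), depending measurably on $\omega$ for each $\epsilon\in I$; (C3) $\lim_{\epsilon\to0}\|\mathbb P_\epsilon-\mathbb P_0\|_{\mathfrak F}=0$. Suppose that for every $f\in\mathfrak F$ the map $\epsilon\mapsto\mathbb P_\epsilon(f):=\int_\Omega f\,d\mathbb P_\epsilon$ is differentiable at $\epsilon=0$, with derivative denoted $\mathbb P_0'(f)$. Let $$\Gamma_\omega:=\sum_{j=0}^\infty\mathcal L_{\sigma^{-j}\omega}^j\Lambda_{\omega,j}h_{\sigma^{-(j+1)}\omega}\in\mathcal B_w,\qquad\omega\in\Omega_0,$$ where the series converges in $\|\cdot\|_w$. Let $\Phi:\Omega\times M\to\mathbb R$ be measurable with $\Phi(\omega,\cdot)\in C^r(M,\mathbb R)$ in case (H), respectively $\Phi(\omega,\cdot)\in L^1(m)$ in case (E), for each $\omega$, such that the functions $$\varphi(\omega):=h_\omega(\Phi(\omega,\cdot)),\qquad\phi(\omega):=\Gamma_\omega(\Phi(\omega,\cdot)),$$ $$\theta(\omega):=\|\Phi(\omega,\cdot)\|_{C^r}\ \text{ in case (H)},\qquad\theta(\omega):=\int_M|\Phi(\omega,\cdot)|\,dm\ \text{ in case (E)},$$ belong to $\mathfrak F$. Then $$\lim_{\epsilon\to0}\frac{\int_{\Omega\times M}\Phi\,d\mu_\epsilon-\int_{\Omega\times M}\Phi\,d\mu}{\epsilon}=\int_\Omega\phi(\omega)\,d\mathbb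 P_0(\omega)+\mathbb P_0'(\varphi),$$ where $\mu_\epsilon$ is the measure on $\Omega\times M$ with $\mu_\epsilon(A\times B)=\int_A h_{\omega,\epsilon}(B)\,d\mathbb P_\epsilon(\omega)$ for measurable $A\subset\Omega$, $B\subset M$, and $\mu:=\mu_0$.
   Context: $\Omega$ is a compact Riemannian manifold with distance $d$, and $I\subset\mathbb R$ is a set containing $0$, with $0$ an accumulation point of $I$. For each $\epsilon\in I$, $\sigma_\epsilon:\Omega\to\Omega$ is a homeomorphism and $\mathbb P_\epsilon$ is a $\sigma_\epsilon$-invariant Borel probability measure on $\Omega$. The map $(\omega,\epsilon)\mapsto\sigma_\epsilon\omega$ is continuous. Write $\sigma=\sigma_0$ and $\mathrm{dist}_{C^0}(\sigma^{-1},\sigma_\epsilon^{-1}):=\max_{y\in\Omega}d(\sigma^{-1}(y),\sigma_\epsilon^{-1}(y))$; $\mathrm{Lip}(\cdot)$ is the Lipschitz constant. $(\mathcal B_w,\|\cdot\|_w)$, $(\mathcal B_s,\|\cdot\|_s)$, $(\mathcal B_{ss},\|\cdot\|_{ss})$ are Banach spaces such that $\mathcal B_{ss}$ is embedded in $\mathcal B_s$, $\mathcal B_s$ is embedded in $\mathcal B_w$, $\|\cdot\|_w\le\|\cdot\|_s$ on $\mathcal B_s$ and $\|\cdot\|_s\le\|\cdot\|_{ss}$ on $\mathcal B_{ss}$. $\psi$ is a non-zero bounded linear functional on $\mathcal B_s$ that admits a bounded extension to $\mathcal B_w$ (still denoted $\psi$) and acts as a bounded functional on $\mathcal B_{ss}$.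 $\mathcal B_s^0:=\{h\in\mathcal B_s:\psi(h)=0\}$. For each $\omega\in\Omega$, $\epsilon\in I$, $\mathcal L_{\omega,\epsilon}$ is a bounded linear operator on both $\mathcal B_s$ and $\mathcal B_w$, and $\psi(\mathcal L_{\omega,\epsilon}h)=\psi(h)$ for all $h\in\mathcal B_w$. For $n\in\mathbb N$, $\mathcal L_{\omega,\epsilon}^n:=\mathcal L_{\sigma_\epsilon^{n-1}\omega,\epsilon}\circ\cdots\circ\mathcal L_{\sigma_\epsilon\omega,\epsilon}\circ\mathcal L_{\omega,\epsilon}$ ($\mathcal L_{\omega,\epsilon}^0=\mathrm{Id}$), $\mathcal L_\omega:=\mathcal L_{\omega,0}$ and $\mathcal L_\omega^j:=\mathcal L_{\omega,0}^j$. $M$ is a compact Riemannian manifold and $m$ is its normalized volume measure. One of two cases is assumed: - Case (E): the elements of $\mathcal B_w$ are bounded measurable functions on $M$ and $\|\cdot\|_\infty\le\|\cdot\|_w$. For functions $g,h$ on $M$ write $h(g)=\int_M g\,h\,dm$ (and $h(B)=\int_B h\,dm$ for a Borel set $B$). - Case (H): there is $r\in\mathbb N$ such that the elements of $\mathcal B_w$ are distributions of order $r$ on $M$, i.e. there is a constant $C>0$ with $|h(\varphi)|\le C\|h\|_w\|\varphi\|_{C^r}$ for all $h\in\mathcal B_w$ and $\varphi\in C^r(M,\mathbb C)$. When $h$ is a Borel measure, $h(\varphi)=\int\varphi\,dh$. $(\mathfrak F,\|\cdot\|_{\mathfrak F})$ is a semi-normed space of bounded measurable real-valued functions on $\Omega$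 such that $\sup_{\epsilon\in I}\sup_{f\in\mathfrak F,\|f\|_{\mathfrak F}\le1}\left|\int_\Omega f\,d\mathbb P_\epsilon\right|<\infty$. For a finite signed Borel measure $\nu$ on $\Omega$, $\|\nu\|_{\mathfrak F}:=\sup_{f\in\mathfrak F,\|f\|_{\mathfrak F}\le1}\left|\int_\Omega f\,d\nu\right|$. Since $h_\omega$ and $\Gamma_\omega$ are defined for $\omega\in\Omega_0$, the formulas for $\varphi$ and $\phi$ are understood for $\omega\in\Omega_0$ (values outside this set being irrelevant as long as the resulting functions lie in $\mathfrak F$). *)

theory Defs
  imports "HOL-Probability.Probability" "HOL-Library.Landau_Symbols" "HOL-Library.Nonpos_Ints"
begin

section \<open>Differentiability of class \<open>C\<^sup>k\<close> on open subsets of Euclidean space\<close>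

definition partial :: "'n \<Rightarrow> (real^'n::finite \<Rightarrow> 'b::real_normed_vector) \<Rightarrow> real^'n \<Rightarrow> 'b" where
  "partial i f x = frechet_derivative f (at x) (axis i 1)"

primrec iter_partial ::
    "'n list \<Rightarrow> (real^'n::finite \<Rightarrow> 'b::real_normed_vector) \<Rightarrow> real^'n \<Rightarrow> 'b" where
  "iter_partial [] f = f"
| "iter_partial (i # is) f = iter_partial is (partial i f)"

text \<open>Meaningful for open \<open>S\<close> only.\<close>

definition Ck_on :: "nat \<Rightarrow> (real^'n::finite) set \<Rightarrow> (real^'n \<Rightarrow> 'b::real_normed_vector) \<Rightarrow> bool" where
  "Ck_on k S f \<longleftrightarrow>
     (\<forall>is. length is \<le> k \<longrightarrow> continuous_on S (iter_partial is f)) \<and>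
     (\<forall>is. length is < k \<longrightarrow> iter_partial is f differentiable_on S)"

definition smooth_on :: "(real^'n::finite) set \<Rightarrow> (real^'n \<Rightarrow> 'b::real_normed_vector) \<Rightarrow> bool" where
  "smooth_on S f \<longleftrightarrow> (\<forall>k. Ck_on k S f)"


section \<open>Riemannian manifolds\<close>

text \<open>A chart is a pair (domain, coordinate map); the coordinate map is only relevant on the domain.
  The underlying set of a manifold is the whole type.\<close>

type_synonym ('x, 'n) chart = "'x set \<times> ('x \<Rightarrow> real^'n)"

abbreviation chart_inv :: "('x, 'n::finite) chart \<Rightarrow> real^'n \<Rightarrow> 'x" where
  "chart_inv c \<equiv> inv_into (fst c) (snd c)"

definition smooth_atlas :: "('x::topological_space, 'n::finite) chart set \<Rightarrow> bool" where
  "smooth_atlas A \<longleftrightarrow>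
     (\<forall>c\<in>A. open (fst c) \<and> open (snd c ` fst c) \<and>
            homeomorphism (fst c) (snd c ` fst c) (snd c) (chart_inv c)) \<and>
     (\<Union>c\<in>A. fst c) = UNIV \<and>
     (\<forall>c\<in>A. \<forall>c'\<in>A. smooth_on (snd c ` (fst c \<inter> fst c')) (snd c' \<circ> chart_inv c))"

text \<open>\<open>G c p\<close> is the Gram matrix of the inner product on the tangent space at \<open>p\<close>, in the
  coordinates given by the chart \<open>c\<close>.\<close>

definition riemannian_metric ::
    "('x::topological_space, 'n::finite) chart set \<Rightarrow> (('x, 'n) chart \<Rightarrow> 'x \<Rightarrow> real^'n^'n) \<Rightarrow> bool" where
  "riemannian_metric A G \<longleftrightarrow>
     (\<forall>c\<in>A. \<forall>p\<in>fst c. transpose (G c p) = G c p \<and> (\<forall>v. v \<noteq> 0 \<longrightarrow> 0 < v \<bullet> (G c p *v v))) \<and>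
     (\<forall>c\<in>A. \<forall>i j. smooth_on (snd c ` fst c) (\<lambda>x. G c (chart_inv c x) $ i $ j)) \<and>
     (\<forall>c\<in>A. \<forall>c'\<in>A. \<forall>p\<in>fst c \<inter> fst c'.
        let J = matrix (frechet_derivative (snd c' \<circ> chart_inv c) (at (snd c p)))
        in G c p = transpose J ** G c' p ** J)"

definition compact_riemannian_manifold ::
    "('x::t2_space, 'n::finite) chart set \<Rightarrow> (('x, 'n) chart \<Rightarrow> 'x \<Rightarrow> real^'n^'n) \<Rightarrow> bool" where
  "compact_riemannian_manifold A G \<longleftrightarrow>
     compact (UNIV :: 'x set) \<and> smooth_atlas A \<and> riemannian_metric A G"

definition piecewise_C1_curve ::
    "('x::topological_space, 'n::finite) chart set \<Rightarrow> (real \<Rightarrow> 'x) \<Rightarrow> bool" where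
  "piecewise_C1_curve A \<gamma> \<longleftrightarrow> path \<gamma> \<and>
     (\<exists>S. finite S \<and>
        (\<forall>c\<in>A. (snd c \<circ> \<gamma>) C1_differentiable_on ({0..1} \<inter> \<gamma> -` fst c - S)))"

text \<open>The choice of the chart does not matter, by the transformation rule for \<open>G\<close>.\<close>

definition speed ::
    "('x::topological_space, 'n::finite) chart set \<Rightarrow> (('x, 'n) chart \<Rightarrow> 'x \<Rightarrow> real^'n^'n)
      \<Rightarrow> (real \<Rightarrow> 'x) \<Rightarrow> real \<Rightarrow> real" where
  "speed A G \<gamma> t =
     (let c = (SOME c. c \<in> A \<and> \<gamma> t \<in> fst c);
          v = vector_derivative (snd c \<circ> \<gamma>) (at t)
      in sqrt (v \<bullet> (G c (\<gamma> t) *v v)))"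

definition curve_length ::
    "('x::topological_space, 'n::finite) chart set \<Rightarrow> (('x, 'n) chart \<Rightarrow> 'x \<Rightarrow> real^'n^'n)
      \<Rightarrow> (real \<Rightarrow> 'x) \<Rightarrow> ennreal" where
  "curve_length A G \<gamma> = (\<integral>\<^sup>+t\<in>{0..1}. ennreal (speed A G \<gamma> t) \<partial>lborel)"

text \<open>The infimum is \<open>\<infinity>\<close> if the two points lie in different components.\<close>

definition riemannian_dist ::
    "('x::topological_space, 'n::finite) chart set \<Rightarrow> (('x, 'n) chart \<Rightarrow> 'x \<Rightarrow> real^'n^'n)
      \<Rightarrow> 'x \<Rightarrow> 'x \<Rightarrow> ennreal" where
  "riemannian_dist A G x y =
     (INF \<gamma>\<in>{\<gamma>. piecewise_C1_curve A \<gamma> \<and> pathstart \<gamma> = x \<and> pathfinish \<gamma> = y}. curve_length A G \<gamma>)"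

text \<open>The metric of the type is the Riemannian distance.  Distances between points of different
  components (a case which does not occur for connected manifolds) are left unspecified.\<close>

definition dist_is_riemannian ::
    "('x::metric_space, 'n::finite) chart set \<Rightarrow> (('x, 'n) chart \<Rightarrow> 'x \<Rightarrow> real^'n^'n) \<Rightarrow> bool" where
  "dist_is_riemannian A G \<longleftrightarrow>
     (\<forall>x y. riemannian_dist A G x y < \<infinity> \<longrightarrow> ennreal (dist x y) = riemannian_dist A G x y)"

definition riemannian_volume ::
    "('x::topological_space, 'n::finite) chart set \<Rightarrow> (('x, 'n) chart \<Rightarrow> 'x \<Rightarrow> real^'n^'n)
      \<Rightarrow> 'x measure \<Rightarrow> bool" where
  "riemannian_volume A G V \<longleftrightarrow> sets V = sets borel \<and>
     (\<forall>c\<in>A. \<forall>B\<in>sets borel. B \<subseteq> fst c \<longrightarrow>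
        emeasure V B = (\<integral>\<^sup>+x\<in>snd c ` B. ennreal (sqrt (det (G c (chart_inv c x)))) \<partial>lborel))"

definition normalized_volume ::
    "('x::topological_space, 'n::finite) chart set \<Rightarrow> (('x, 'n) chart \<Rightarrow> 'x \<Rightarrow> real^'n^'n)
      \<Rightarrow> 'x measure \<Rightarrow> bool" where
  "normalized_volume A G m \<longleftrightarrow>
     (\<exists>V. riemannian_volume A G V \<and> m = scale_measure (inverse (emeasure V UNIV)) V)"

definition curve_differentiable_at ::
    "('x::topological_space, 'n::finite) chart set \<Rightarrow> real set \<Rightarrow> (real \<Rightarrow> 'x) \<Rightarrow> real \<Rightarrow> bool" where
  "curve_differentiable_at A I \<gamma> t \<longleftrightarrow>
     continuous (at t within I) \<gamma> \<and>
     (\<forall>c\<in>A. \<gamma> t \<in> fst c \<longrightarrow> (snd c \<circ> \<gamma>) differentiable (at t within I))"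

definition Cr_manifold ::
    "('x::topological_space, 'n::finite) chart set \<Rightarrow> nat \<Rightarrow> ('x \<Rightarrow> complex) set" where
  "Cr_manifold A r = {f. \<forall>c\<in>A. Ck_on r (snd c ` fst c) (f \<circ> chart_inv c)}"

text \<open>The \<open>C\<^sup>r\<close> norm on a compact manifold depends, up to equivalence, on the choice of a finite
  cover of the manifold by compact sets contained in chart domains.\<close>

definition chart_cover ::
    "('x::topological_space, 'n::finite) chart set \<Rightarrow> (('x, 'n) chart \<times> 'x set) set \<Rightarrow> bool" where
  "chart_cover A N \<longleftrightarrow> finite N \<and>
     (\<forall>(c, K)\<in>N. c \<in> A \<and> compact K \<and> K \<subseteq> fst c) \<and> (\<Union>(c, K)\<in>N. K) = UNIV"

definition Cr_norm ::
    "(('x::topological_space, 'n::finite) chart \<times> 'x set) set \<Rightarrow> nat \<Rightarrow> ('x \<Rightarrow> complex) \<Rightarrow> real" where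
  "Cr_norm N r f =
     Sup {norm (iter_partial is (f \<circ> chart_inv c) (snd c p)) | is c K p.
            length is \<le> r \<and> (c, K) \<in> N \<and> p \<in> K}"


section \<open>Spaces of functions and distributions\<close>

text \<open>Banach spaces are real Banach spaces and linear maps are \<open>\<real>\<close>-linear, with complex values where
  the scalars may be complex; by restriction of scalars this covers both real and complex Banach
  spaces.  \<open>fn h\<close> is the function given by the element \<open>h\<close>, and \<open>D h\<close> the distribution given by \<open>h\<close>
  (only its values on \<open>C\<^sup>r\<close> functions matter).\<close>

definition bounded_function_space ::
    "('w::real_normed_vector \<Rightarrow> 'm::topological_space \<Rightarrow> complex) \<Rightarrow> bool" where
  "bounded_function_space fn \<longleftrightarrow>
     (\<forall>x. linear (\<lambda>h. fn h x)) \<and> inj fn \<and>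
     (\<forall>h. fn h \<in> borel_measurable borel) \<and> (\<forall>h x. norm (fn h x) \<le> norm h)"

definition distribution_space ::
    "('m::topological_space, 'k::finite) chart set \<Rightarrow> (('m, 'k) chart \<times> 'm set) set \<Rightarrow> nat
      \<Rightarrow> ('w::real_normed_vector \<Rightarrow> ('m \<Rightarrow> complex) \<Rightarrow> complex) \<Rightarrow> bool" where
  "distribution_space A N r D \<longleftrightarrow>
     (\<forall>h. \<forall>f\<in>Cr_manifold A r. \<forall>g\<in>Cr_manifold A r. \<forall>a b.
        D h (\<lambda>x. a * f x + b * g x) = a * D h f + b * D h g) \<and>
     (\<forall>f\<in>Cr_manifold A r. linear (\<lambda>h. D h f)) \<and>
     (\<forall>h h'. (\<forall>f\<in>Cr_manifold A r. D h f = D h' f) \<longrightarrow> h = h') \<and>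
     (\<exists>C>0. \<forall>h. \<forall>f\<in>Cr_manifold A r. norm (D h f) \<le> C * norm h * Cr_norm N r f)"

text \<open>The value \<open>h(g)\<close>: the flag \<open>E\<close> tells whether elements are functions or distributions.\<close>

definition pairing ::
    "bool \<Rightarrow> 'm measure \<Rightarrow> ('w \<Rightarrow> 'm \<Rightarrow> complex) \<Rightarrow> ('w \<Rightarrow> ('m \<Rightarrow> complex) \<Rightarrow> complex)
      \<Rightarrow> 'w \<Rightarrow> ('m \<Rightarrow> complex) \<Rightarrow> complex" where
  "pairing E m fn D h g = (if E then (\<integral>x. g x * fn h x \<partial>m) else D h g)"

definition seminormed_function_space ::
    "('o::topological_space \<Rightarrow> real) set \<Rightarrow> (('o \<Rightarrow> real) \<Rightarrow> real) \<Rightarrow> bool" where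
  "seminormed_function_space F nF \<longleftrightarrow>
     (\<lambda>_. 0) \<in> F \<and>
     (\<forall>f\<in>F. \<forall>g\<in>F. (\<lambda>x. f x + g x) \<in> F \<and> nF (\<lambda>x. f x + g x) \<le> nF f + nF g) \<and>
     (\<forall>a. \<forall>f\<in>F. (\<lambda>x. a * f x) \<in> F \<and> nF (\<lambda>x. a * f x) = \<bar>a\<bar> * nF f) \<and>
     (\<forall>f\<in>F. 0 \<le> nF f \<and> f \<in> borel_measurable borel \<and> bounded (range f))"

text \<open>\<open>\<parallel>P - Q\<parallel>\<close> in the dual seminorm, for finite measures \<open>P\<close>, \<open>Q\<close>.\<close>

definition dual_seminorm_diff ::
    "('o \<Rightarrow> real) set \<Rightarrow> (('o \<Rightarrow> real) \<Rightarrow> real) \<Rightarrow> 'o measure \<Rightarrow> 'o measure \<Rightarrow> real" where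
  "dual_seminorm_diff F nF P Q = (SUP f\<in>{f\<in>F. nF f \<le> 1}. \<bar>(\<integral>x. f x \<partial>P) - (\<integral>x. f x \<partial>Q)\<bar>)"


section \<open>Operator cocycles\<close>

primrec cocycle ::
    "('o \<Rightarrow> 'o) \<Rightarrow> ('o \<Rightarrow> 'b::real_normed_vector \<Rightarrow>\<^sub>L 'b) \<Rightarrow> nat \<Rightarrow> 'o \<Rightarrow> 'b \<Rightarrow>\<^sub>L 'b" where
  "cocycle s L 0 \<omega> = id_blinfun"
| "cocycle s L (Suc n) \<omega> = L ((s ^^ n) \<omega>) o\<^sub>L cocycle s L n \<omega>"

definition dist_C0 :: "('o \<Rightarrow> 'o::metric_space) \<Rightarrow> ('o \<Rightarrow> 'o) \<Rightarrow> real" where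
  "dist_C0 f g = (SUP y. dist (f y) (g y))"

text \<open>\<open>D\<close> is the derivative at \<open>\<epsilon> = 0\<close> of \<open>\<epsilon> \<mapsto> L (\<gamma> \<epsilon>) \<epsilon>\<close>, as an operator from the strongest space
  (embedded by \<open>e\<close>) into the kernel of \<open>\<psi>\<close>, with explicit remainder.\<close>

definition operator_derivative ::
    "real set \<Rightarrow> real \<Rightarrow> real \<Rightarrow> ('ss::real_normed_vector \<Rightarrow> 's::real_normed_vector)
      \<Rightarrow> ('s \<Rightarrow> complex) \<Rightarrow> ('o::metric_space \<Rightarrow> real \<Rightarrow> 's \<Rightarrow>\<^sub>L 's) \<Rightarrow> (real \<Rightarrow> 'o)
      \<Rightarrow> ('ss \<Rightarrow>\<^sub>L 's) \<Rightarrow> bool" where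
  "operator_derivative I C \<zeta> e \<psi> L \<gamma> D \<longleftrightarrow>
     (\<forall>g. \<psi> (D g) = 0) \<and>
     (\<forall>g. \<forall>\<epsilon>\<in>I. norm ((L (\<gamma> \<epsilon>) \<epsilon> (e g) - L (\<gamma> 0) 0 (e g)) - \<epsilon> *\<^sub>R D g)
        \<le> C * (\<bar>\<epsilon>\<bar> powr (1 + \<zeta>) + dist (\<gamma> \<epsilon>) (\<gamma> 0) powr (1 + \<zeta>)) * norm g)"

end

theory Submission
  imports Defs
begin

text \<open>Write \<open>h\<^sub>\<epsilon>\<close> and \<open>h\<close> for the equilibria at \<open>\<omega>\<close> and telescope along the two backward orbits of \<open>\<omega>\<close>:
  the difference \<open>h\<^sub>\<epsilon> - h\<close> is the sum over \<open>j\<close> of the perturbed \<open>j\<close>-step cocycle applied to the defect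
  of the unperturbed equilibrium after one perturbed step. Since \<open>\<sigma>\<^sub>\<epsilon>\<^sup>-\<^sup>j \<omega>\<close> and \<open>\<sigma>\<^sup>-\<^sup>j \<omega>\<close> are
  \<open>O(\<bar>\<epsilon>\<bar> e\<^sup>b\<^sup>j)\<close> apart, the defect is \<open>\<epsilon> \<Lambda> h\<close> up to \<open>O(\<bar>\<epsilon>\<bar>\<^sup>1\<^sup>+\<^sup>\<zeta> e\<^sup>(\<^sup>1\<^sup>+\<^sup>\<zeta>\<^sup>)\<^sup>b\<^sup>j)\<close>, which the decay
  \<open>e\<^sup>-\<^sup>\<alpha>\<^sup>j\<close> sums. A second telescoping replaces the perturbed cocycle by the unperturbed one, so that
  \<open>h\<^sub>\<epsilon> - h - \<epsilon> \<Gamma> = O(\<bar>\<epsilon>\<bar> (\<bar>\<epsilon>\<bar>\<^sup>\<zeta> + \<bar>\<epsilon>\<bar>\<^sup>\<zeta>\<^sup>/\<^sup>2))\<close> in the weak norm, uniformly in \<open>\<omega>\<close>. Pairing with \<open>\<Phi>\<close> and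
  integrating over \<open>\<omega>\<close>, what remains is the differentiability of \<open>P \<epsilon>\<close> on the test function \<open>\<phi>\<^sub>h\<close> and
  its continuity on \<open>\<phi>\<^sub>\<Gamma>\<close>.\<close>

section \<open>Backward operator products\<close>

text \<open>For \<open>A i = L (\<sigma>\<^sup>-\<^sup>(\<^sup>i\<^sup>+\<^sup>1\<^sup>) \<omega>)\<close> this is the cocycle over \<open>n\<close> steps started at \<open>\<sigma>\<^sup>-\<^sup>n \<omega>\<close> and
  ending at \<open>\<omega>\<close>.\<close>

primrec backward_product :: "(nat \<Rightarrow> 'b::real_normed_vector \<Rightarrow>\<^sub>L 'b) \<Rightarrow> nat \<Rightarrow> 'b \<Rightarrow>\<^sub>L 'b" where
  "backward_product A 0 = id_blinfun"
| "backward_product A (Suc n) = backward_product A n o\<^sub>L A n"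

text \<open>Since \<open>backward_product A j (A j v) = backward_product A (Suc j) v\<close>, each
  summand is a difference of consecutive values of \<open>backward_product A j (x j)\<close>. No
  relation between \<open>A\<close> and \<open>x\<close> enters, so the identity serves exact and
  approximate orbits alike.\<close>

lemma backward_product_telescope:
  "backward_product A n (x n) - x 0 = (\<Sum>j<n. backward_product A j (A j (x (Suc j)) - x j))"
  by (induction n) (simp_all add: blinfun.diff_right algebra_simps)

lemma backward_product_fixed:
  fixes A :: "nat \<Rightarrow> 'w::real_normed_vector \<Rightarrow>\<^sub>L 'w"
  assumes "\<And>j. A j (x (Suc j)) = x j"
  shows "backward_product A n (x n) = x 0"
  using backward_product_telescope[of A n x] assms by simp

text \<open>Subtracting the telescoping identity for \<open>y\<close> from
  \<open>backward_product A n (x n) = x 0\<close> leaves the tail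
  \<open>backward_product A n (x n - y n)\<close>. It tends to 0 because \<open>x n - y n\<close> is
  bounded and stays in the kernel of \<psi>.\<close>

lemma backward_product_equilibrium_expansion:
  fixes A :: "nat \<Rightarrow> 'w::real_normed_vector \<Rightarrow>\<^sub>L 'w"
  assumes a: "0 \<le> a" "a < 1"
    and decay: "\<And>n v. \<psi> v = 0 \<Longrightarrow> norm (backward_product A n v) \<le> C * a ^ n * norm v"
    and x: "\<And>j. A j (x (Suc j)) = x j"
    and \<psi>: "\<And>j. \<psi> (x j - y j) = 0"
    and bound: "\<And>j. norm (x j - y j) \<le> B" and C: "C \<ge> 0"
  shows "(\<lambda>j. backward_product A j (A j (y (Suc j)) - y j)) sums (x 0 - y 0)"
proof -
  have "(\<lambda>n. backward_product A n (x n - y n)) \<longlonglongrightarrow> 0"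
  proof (rule Lim_null_comparison)
    have "norm (backward_product A n (x n - y n)) \<le> C * a ^ n * B" for n
      using decay[OF \<psi>, of n n] mult_left_mono[OF bound[of n], of "C * a ^ n"] a C by simp
    then show "\<forall>\<^sub>F n in sequentially. norm (backward_product A n (x n - y n)) \<le> C * a ^ n * B"
      by simp
    show "(\<lambda>n. C * a ^ n * B) \<longlonglongrightarrow> 0"
      using a by (intro tendsto_mult_left_zero tendsto_mult_right_zero LIMSEQ_power_zero) auto
  qed
  moreover have "backward_product A n (x n - y n)
      = (x 0 - y 0) - (\<Sum>j<n. backward_product A j (A j (y (Suc j)) - y j))" for n
    using backward_product_telescope[of A n y] backward_product_fixed[of A x n, OF x]
    by (simp add: blinfun.diff_right algebra_simps)
  ultimately show ?thesis
    unfolding sums_def by (simp add: tendsto_iff dist_norm norm_minus_commute)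
qed

text \<open>As \<open>x\<close> is an exact orbit for \<open>B\<close>, the difference is the
  telescoped sum of its defects under \<open>A\<close>. The decay \<open>a ^ i\<close> beats the
  growth \<open>\<beta> ^ i\<close> of the defects, and the full geometric series gives a bound
  independent of \<open>n\<close>. The hypotheses stop at \<open>n\<close> because in the
  application the orbit only starts there.\<close>

lemma backward_product_difference_bound:
  fixes A B :: "nat \<Rightarrow> 'w::real_normed_vector \<Rightarrow>\<^sub>L 'w"
  assumes a: "0 \<le> a" "0 \<le> \<beta>" "a * \<beta> < 1" and C: "0 \<le> C" "0 \<le> M" "0 \<le> \<eta>"
    and decay: "\<And>n v. \<psi> v = 0 \<Longrightarrow> norm (backward_product A n v) \<le> C * a ^ n * norm v"
    and x: "\<And>i. i < n \<Longrightarrow> B i (x (Suc i)) = x i"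
    and \<psi>: "\<And>i. i < n \<Longrightarrow> \<psi> (A i (x (Suc i)) - x i) = 0"
    and bound: "\<And>i. i < n \<Longrightarrow> norm (A i (x (Suc i)) - x i) \<le> M * \<beta> ^ i * \<eta>"
  shows "norm (backward_product A n (x n) - backward_product B n (x n)) \<le> C * M * \<eta> / (1 - a * \<beta>)"
proof -
  have "backward_product B n (x n) - x 0 = 0"
    using x by (simp add: backward_product_telescope)
  then have "norm (backward_product A n (x n) - backward_product B n (x n))
      = norm (\<Sum>i<n. backward_product A i (A i (x (Suc i)) - x i))"
    using backward_product_telescope[of A n x] by simp
  also have "\<dots> \<le> (\<Sum>i<n. C * M * \<eta> * (a * \<beta>) ^ i)"
  proof (rule sum_norm_le)
    fix i assume "i \<in> {..<n}"
    then have i: "i < n" by simp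
    have "norm (backward_product A i (A i (x (Suc i)) - x i))
        \<le> C * a ^ i * norm (A i (x (Suc i)) - x i)"
      by (rule decay[OF \<psi>[OF i]])
    also have "\<dots> \<le> C * a ^ i * (M * \<beta> ^ i * \<eta>)"
      using bound[OF i] a C by (intro mult_left_mono) auto
    finally show "norm (backward_product A i (A i (x (Suc i)) - x i)) \<le> C * M * \<eta> * (a * \<beta>) ^ i"
      by (simp add: power_mult_distrib mult_ac)
  qed
  also have "\<dots> = C * M * \<eta> * (\<Sum>i<n. (a * \<beta>) ^ i)"
    by (simp add: sum_distrib_left)
  also have "\<dots> \<le> C * M * \<eta> * (1 / (1 - a * \<beta>))"
  proof -
    have "(\<Sum>i<n. (a * \<beta>) ^ i) \<le> (\<Sum>i. (a * \<beta>) ^ i)"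
      using a by (intro sum_le_suminf summable_geometric) auto
    also have "\<dots> = 1 / (1 - a * \<beta>)"
      using a by (intro suminf_geometric) auto
    finally show ?thesis using C by (intro mult_left_mono) auto
  qed
  finally show ?thesis by simp
qed

text \<open>\<open>x\<close> and \<open>y\<close> are the perturbed and unperturbed equilibria along the backward orbit, and \<open>z j\<close>
  carries \<open>g j\<close> forward along the unperturbed orbit from time \<open>j\<close> to time \<open>0\<close>.\<close>

lemma linear_response_estimate:
  fixes A B :: "nat \<Rightarrow> 'w::banach \<Rightarrow>\<^sub>L 'w"
  assumes a: "0 < a" "a < 1" "0 \<le> \<beta>" "a * \<beta> < 1" and C: "0 \<le> C" "0 \<le> M" "0 \<le> \<eta>" "0 \<le> G"
    and \<psi>: "linear \<psi>" "\<And>j v. \<psi> (A j v) = \<psi> v" "\<And>j v. \<psi> (B j v) = \<psi> v"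
    and decay: "\<And>n v. \<psi> v = 0 \<Longrightarrow> norm (backward_product A n v) \<le> C * a ^ n * norm v"
      "\<And>n v. \<psi> v = 0 \<Longrightarrow> norm (backward_product B n v) \<le> C * a ^ n * norm v"
    and x: "\<And>j. A j (x (Suc j)) = x j"
    and xy: "\<And>j. \<psi> (x j) = u" "\<And>j. \<psi> (y j) = u"  "\<And>j. norm (x j - y j) \<le> H"
    and g: "\<And>j. \<psi> (g j) = 0" "\<And>j. norm (g j) \<le> G"
    and R: "\<And>j. norm (A j (y (Suc j)) - y j - e *\<^sub>R g j) \<le> M * \<beta> ^ j * (\<bar>e\<bar> * \<eta>)"
    and z: "\<And>j. z j j = g j" "\<And>j i. i < j \<Longrightarrow> B i (z j (Suc i)) = z j i"
      "\<And>j i. i < j \<Longrightarrow> norm (A i (z j (Suc i)) - z j i) \<le> M * \<beta> ^ i * \<eta>"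
  shows "norm (x 0 - y 0 - e *\<^sub>R (\<Sum>j. backward_product B j (g j)))
    \<le> \<bar>e\<bar> * (C * M * \<eta> / (1 - a * \<beta>)
        + sqrt (2 * C\<^sup>2 * M * G / (1 - a * \<beta>)) * sqrt \<eta> / (1 - sqrt a))"
    (is "_ \<le> ?rhs")
    and "summable (\<lambda>j. backward_product B j (g j))"
proof -
  interpret \<psi>: linear \<psi> by (rule \<psi>(1))
  let ?T = "backward_product A" and ?S = "backward_product B"
  define R where "R j = A j (y (Suc j)) - y j - e *\<^sub>R g j" for j
  have A_decomp: "A j (y (Suc j)) - y j = R j + e *\<^sub>R g j" for j
    by (simp add: R_def)
  have \<psi>R: "\<psi> (R j) = 0" for j
    by (simp add: R_def \<psi>.diff \<psi>.scale \<psi>(2) xy g)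
  have T_sums: "(\<lambda>j. ?T j (A j (y (Suc j)) - y j)) sums (x 0 - y 0)"
    by (rule backward_product_equilibrium_expansion[of a \<psi> A C x y H])
      (use a C decay x xy in \<open>auto simp: \<psi>.diff\<close>)
  have g_bound: "norm (?T j (g j)) \<le> C * G * a ^ j" "norm (?S j (g j)) \<le> C * G * a ^ j" for j
  proof -
    have "C * a ^ j * norm (g j) \<le> C * a ^ j * G"
      using g(2)[of j] a C by (intro mult_left_mono) auto
    then show "norm (?T j (g j)) \<le> C * G * a ^ j" "norm (?S j (g j)) \<le> C * G * a ^ j"
      using decay(1)[OF g(1), of j j] decay(2)[OF g(1), of j j] by (simp_all add: mult_ac)
  qed
  show summable: "summable (\<lambda>j. ?S j (g j))"
  proof (rule summable_comparison_test')
    show "summable (\<lambda>j. C * G * a ^ j)"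
      using a by (intro summable_mult summable_geometric) auto
  qed (rule g_bound)
  have S_sums: "(\<lambda>j. ?S j (g j)) sums (\<Sum>j. ?S j (g j))"
    using summable by (rule summable_sums)
  \<comment> \<open>Each \<open>?D j\<close> splits into the perturbed product applied to the
    remainder \<open>R j\<close> and \<open>e\<close> times the difference of the two products at
    \<open>g j\<close>. These give the two geometric series in \<open>bound_sums\<close>.\<close>
  let ?D = "\<lambda>j. ?T j (A j (y (Suc j)) - y j) - e *\<^sub>R ?S j (g j)"
  \<comment> \<open>The square root of the product of the bounds \<open>d1\<close> and
    \<open>d2\<close> below, without its factor \<open>sqrt a ^ j\<close>.\<close>
  let ?c = "sqrt (2 * C\<^sup>2 * M * G / (1 - a * \<beta>)) * sqrt \<eta>"
  have D_sums: "?D sums (x 0 - y 0 - e *\<^sub>R (\<Sum>j. ?S j (g j)))"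
    using T_sums S_sums by (intro sums_diff sums_scaleR_right)
  have sqrt_a: "0 < sqrt a" "sqrt a < 1" using a by auto
  have bound_sums: "(\<lambda>j. C * M * (\<bar>e\<bar> * \<eta>) * (a * \<beta>) ^ j + \<bar>e\<bar> * ?c * sqrt a ^ j) sums
     (C * M * (\<bar>e\<bar> * \<eta>) * (1 / (1 - a * \<beta>)) + \<bar>e\<bar> * ?c * (1 / (1 - sqrt a)))"
    using a sqrt_a by (intro sums_add sums_mult geometric_sums) auto
  have "norm (?D j) \<le> C * M * (\<bar>e\<bar> * \<eta>) * (a * \<beta>) ^ j + \<bar>e\<bar> * ?c * sqrt a ^ j" for j
  proof -
    have "norm (?T j (R j)) \<le> C * a ^ j * norm (R j)"
      by (rule decay(1)[OF \<psi>R])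
    also have "\<dots> \<le> C * a ^ j * (M * \<beta> ^ j * (\<bar>e\<bar> * \<eta>))"
      using R[of j] a C by (intro mult_left_mono) (auto simp: R_def)
    finally have 1: "norm (?T j (R j)) \<le> C * M * (\<bar>e\<bar> * \<eta>) * (a * \<beta>) ^ j"
      by (simp add: power_mult_distrib mult_ac)
    define d where "d = norm (?T j (g j) - ?S j (g j))"
    \<comment> \<open>Writing \<open>g j\<close> as \<open>z j j\<close> makes \<open>z j\<close>
      the exact \<open>B\<close>-orbit to compare along. Its defects under \<open>A\<close> lie in
      the kernel of \<psi>: once \<open>z j i\<close> is rewritten as
      \<open>B i (z j (Suc i))\<close>, both terms have the same value under \<psi>.\<close>
    have d1: "d \<le> C * M * \<eta> / (1 - a * \<beta>)"
      unfolding d_def z(1)[symmetric, of j]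
      by (rule backward_product_difference_bound[where \<psi> = \<psi>])
        (use a C decay z in \<open>auto simp: \<psi>.diff \<psi>(2,3) simp flip: z(2)\<close>)
    have d2: "d \<le> 2 * C * G * a ^ j"
      unfolding d_def using g_bound[of j] norm_triangle_ineq4[of "?T j (g j)" "?S j (g j)"] by simp
    \<comment> \<open>The geometric mean of a bound that is small in \<open>\<eta>\<close> and one that decays in \<open>j\<close> is summable
      and still small.\<close>
    have "d * d \<le> (C * M * \<eta> / (1 - a * \<beta>)) * (2 * C * G * a ^ j)"
      using a C by (intro mult_mono d1 d2) (auto simp: d_def)
    also have "\<dots> = 2 * C\<^sup>2 * M * G / (1 - a * \<beta>) * \<eta> * a ^ j"
      by (simp add: power2_eq_square)
    finally have "sqrt (d * d) \<le> sqrt (2 * C\<^sup>2 * M * G / (1 - a * \<beta>) * \<eta> * a ^ j)"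
      by (rule real_sqrt_le_mono)
    also have "sqrt (2 * C\<^sup>2 * M * G / (1 - a * \<beta>) * \<eta> * a ^ j) = ?c * sqrt a ^ j"
      by (simp only: real_sqrt_mult real_sqrt_power)
    finally have "d \<le> ?c * sqrt a ^ j"
      by (simp add: d_def)
    then have 2: "norm (e *\<^sub>R (?T j (g j) - ?S j (g j))) \<le> \<bar>e\<bar> * ?c * sqrt a ^ j"
      unfolding d_def by (simp add: mult_left_mono mult.assoc)
    have "?D j = ?T j (R j) + e *\<^sub>R (?T j (g j) - ?S j (g j))"
      unfolding A_decomp by (simp add: blinfun.add_right blinfun.scaleR_right algebra_simps)
    then show ?thesis
      using norm_triangle_mono[OF 1 2] by simp
  qed
  then have "norm (\<Sum>j. ?D j) \<le> (\<Sum>j. C * M * (\<bar>e\<bar> * \<eta>) * (a * \<beta>) ^ j + \<bar>e\<bar> * ?c * sqrt a ^ j)"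
    by (rule norm_suminf_le) (rule sums_summable[OF bound_sums])
  then show "norm (x 0 - y 0 - e *\<^sub>R (\<Sum>j. ?S j (g j))) \<le> ?rhs"
    unfolding sums_unique[OF D_sums, symmetric] sums_unique[OF bound_sums, symmetric]
    by (simp add: algebra_simps)
qed

section \<open>Quenched linear response\<close>

lemma cocycle_Suc_right: "cocycle s L (Suc n) \<omega> = cocycle s L n (s \<omega>) o\<^sub>L L \<omega>"
  by (induction n) (auto intro!: blinfun_eqI simp: funpow_swap1)

text \<open>Peeling off the earliest operator, the one at \<open>(t ^^ Suc n) \<omega>\<close>,
  leaves an \<open>n\<close>-step cocycle started at the image of that point under \<open>s\<close>,
  which is \<open>(t ^^ n) \<omega>\<close>.\<close>

lemma cocycle_eq_backward_product:
  assumes "\<And>y. s (t y) = y"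
  shows "cocycle s L n ((t ^^ n) \<omega>) = backward_product (\<lambda>i. L ((t ^^ Suc i) \<omega>)) n"
proof (induction n)
  case (Suc n)
  have "cocycle s L (Suc n) ((t ^^ Suc n) \<omega>)
      = cocycle s L n ((t ^^ n) \<omega>) o\<^sub>L L ((t ^^ Suc n) \<omega>)"
    unfolding cocycle_Suc_right by (simp add: assms)
  then show ?case by (simp add: Suc)
qed simp

lemma funpow_cancel:
  assumes "\<And>y. s (t y) = y"
  shows "(s ^^ k) ((t ^^ (k + n)) y) = (t ^^ n) y"
proof (induction k)
  case (Suc k)
  show ?case unfolding funpow_Suc_right[of k s] by (simp add: assms Suc)
qed simp

text \<open>The intermediate point \<open>(f ^^ k) (g x)\<close> separates the error of the first
  step, expanded by at most \<open>l k\<close>, from \<open>k\<close> further steps started at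
  \<open>g x\<close>; hence the induction runs over all \<open>x\<close>. Expansion is measured by
  the unperturbed iterates alone.\<close>

lemma dist_funpow_perturbation:
  fixes f g :: "'a::metric_space \<Rightarrow> 'a"
  assumes lip: "\<And>k. (l k)-lipschitz_on UNIV (f ^^ k)" and d: "\<And>y. dist (g y) (f y) \<le> d"
  shows "dist ((g ^^ k) x) ((f ^^ k) x) \<le> d * (\<Sum>i<k. l i)"
proof (induction k arbitrary: x)
  case (Suc k)
  have "dist ((g ^^ Suc k) x) ((f ^^ Suc k) x)
      \<le> dist ((g ^^ k) (g x)) ((f ^^ k) (g x)) + dist ((f ^^ k) (g x)) ((f ^^ k) (f x))"
    by (simp add: funpow_swap1 dist_triangle)
  also have "\<dots> \<le> d * (\<Sum>i<k. l i) + l k * d"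
  proof (intro add_mono Suc)
    have "dist ((f ^^ k) (g x)) ((f ^^ k) (f x)) \<le> l k * dist (g x) (f x)"
      by (rule lipschitz_onD[OF lip]) auto
    also have "\<dots> \<le> l k * d"
      using d[of x] lipschitz_on_nonneg[OF lip[of k]] by (rule mult_left_mono)
    finally show "dist ((f ^^ k) (g x)) ((f ^^ k) (f x)) \<le> l k * d" .
  qed
  finally show ?case by (simp add: algebra_simps)
qed simp

text \<open>Raising the rate from \<open>c\<close> to a positive \<open>b\<close> makes the
  geometric sum at most a constant times \<open>exp b ^ k\<close>, even when
  \<open>c \<le> 0\<close>.\<close>

lemma dist_funpow_perturbation_geometric:
  fixes f g :: "'a::metric_space \<Rightarrow> 'a"
  assumes lip: "\<And>k. (C * exp (c * real k))-lipschitz_on UNIV (f ^^ k)"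
    and d: "\<And>y. dist (g y) (f y) \<le> d" and b: "c \<le> b" "0 < b" and C: "0 \<le> C"
  shows "dist ((g ^^ k) x) ((f ^^ k) x) \<le> C / (exp b - 1) * d * exp b ^ k"
proof -
  have "0 \<le> d" using d[of x] zero_le_dist[of "g x" "f x"] by linarith
  have "dist ((g ^^ k) x) ((f ^^ k) x) \<le> d * (\<Sum>i<k. C * exp (c * real i))"
    using lip d by (rule dist_funpow_perturbation)
  also have "\<dots> \<le> d * (\<Sum>i<k. C * exp b ^ i)"
  proof (intro mult_left_mono sum_mono)
    show "exp (c * real i) \<le> exp b ^ i" for i
      using mult_right_mono[OF b(1), of "real i"] by (simp flip: exp_of_nat2_mult)
  qed (use C \<open>0 \<le> d\<close> in auto)
  also have "\<dots> = d * C * ((exp b ^ k - 1) / (exp b - 1))"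
    using b by (simp add: geometric_sum flip: sum_distrib_left)
  also have "\<dots> \<le> d * C * (exp b ^ k / (exp b - 1))"
    using b C \<open>0 \<le> d\<close> by (intro mult_left_mono divide_right_mono) auto
  finally show ?thesis by (simp add: mult_ac)
qed

lemma inverse_orbit_in_invariant_set:
  assumes "bij s" "s -` S = S" "\<omega> \<in> S"
  shows "(inv s ^^ k) \<omega> \<in> S"
proof (induction k)
  case (Suc k)
  have "s (inv s y) = y" for y using assms(1) by (simp add: bij_is_surj surj_f_inv_f)
  then show ?case using Suc assms(2) by (metis funpow.simps(2) comp_apply vimage_eq)
qed (simp add: assms)

text \<open>Applies \<open>linear_response_estimate\<close> to the two backward orbits of each
  \<omega>. \<open>B\<close> is chosen before \<epsilon> and \<omega>, as the later integration over
  \<omega> requires. Closeness of the inverse maps is a premise on each \<epsilon>, because (B5)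
  grants it only near 0; at \<epsilon> = 0 it is trivial.\<close>

lemma quenched_linear_response:
  fixes \<sigma> :: "real \<Rightarrow> 'o::metric_space \<Rightarrow> 'o"
    and i\<^sub>s :: "'s::banach \<Rightarrow> 'w::banach" and i\<^sub>s\<^sub>s :: "'ss::banach \<Rightarrow> 's"
    and \<psi> :: "'w \<Rightarrow>\<^sub>L complex"
    and Lw :: "'o \<Rightarrow> real \<Rightarrow> 'w \<Rightarrow>\<^sub>L 'w" and Ls :: "'o \<Rightarrow> real \<Rightarrow> 's \<Rightarrow>\<^sub>L 's"
    and \<Lambda> :: "'o \<Rightarrow> nat \<Rightarrow> 'ss \<Rightarrow>\<^sub>L 's"
  assumes "0 \<in> I"
    and bij: "\<And>\<epsilon>. \<epsilon> \<in> I \<Longrightarrow> bij (\<sigma> \<epsilon>)"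
    and embed_s: "bounded_linear i\<^sub>s" "\<And>g. norm (i\<^sub>s g) \<le> norm g"
    and L_compat: "\<And>\<omega> \<epsilon> g. \<epsilon> \<in> I \<Longrightarrow> i\<^sub>s (Ls \<omega> \<epsilon> g) = Lw \<omega> \<epsilon> (i\<^sub>s g)"
    and L_\<psi>: "\<And>\<omega> \<epsilon> g. \<epsilon> \<in> I \<Longrightarrow> \<psi> (Lw \<omega> \<epsilon> g) = \<psi> g"
    and constants: "C > 0" "\<alpha> > 0" "0 < \<zeta>"
    and \<Omega>\<^sub>e: "\<And>\<epsilon>. \<epsilon> \<in> I \<Longrightarrow> \<sigma> \<epsilon> -` \<Omega>\<^sub>e \<epsilon> = \<Omega>\<^sub>e \<epsilon>"
    and A1: "\<And>n \<epsilon> \<omega> g. \<epsilon> \<in> I \<Longrightarrow> \<omega> \<in> \<Omega>\<^sub>e \<epsilon> \<Longrightarrow> \<psi> g = 0 \<Longrightarrow>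
        norm (cocycle (\<sigma> \<epsilon>) (\<lambda>\<omega>. Lw \<omega> \<epsilon>) n \<omega> g) \<le> C * exp (- \<alpha> * real n) * norm g"
    and A2: "\<And>\<epsilon> \<omega> \<omega>' g. \<epsilon> \<in> I \<Longrightarrow> \<omega> \<in> \<Omega>\<^sub>e \<epsilon> \<Longrightarrow> \<omega>' \<in> \<Omega>\<^sub>e 0 \<Longrightarrow>
        norm (Lw \<omega> \<epsilon> (i\<^sub>s g) - Lw \<omega>' 0 (i\<^sub>s g)) \<le> C * (dist \<omega> \<omega>' powr \<zeta> + \<bar>\<epsilon>\<bar> powr \<zeta>) * norm g"
    and A3: "\<And>\<epsilon> \<omega>. \<epsilon> \<in> I \<Longrightarrow> \<omega> \<in> \<Omega>\<^sub>e \<epsilon> \<Longrightarrow> \<psi> (i\<^sub>s (h \<epsilon> \<omega>)) = 1 \<and> norm (h \<epsilon> \<omega>) \<le> C"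
    and A4: "\<And>\<epsilon> \<omega>. \<epsilon> \<in> I \<Longrightarrow> \<omega> \<in> \<Omega>\<^sub>e \<epsilon> \<Longrightarrow> Ls \<omega> \<epsilon> (h \<epsilon> \<omega>) = h \<epsilon> (\<sigma> \<epsilon> \<omega>)"
    and B1: "\<And>\<omega> j. \<omega> \<in> \<Omega>\<^sub>e 0 \<Longrightarrow> norm (cocycle (\<sigma> 0) (\<lambda>\<omega>. Ls \<omega> 0) j \<omega>) \<le> K"
    and B2: "\<And>\<omega>. \<omega> \<in> \<Omega>\<^sub>e 0 \<Longrightarrow> i\<^sub>s\<^sub>s (h\<^sub>s\<^sub>s \<omega>) = h 0 \<omega> \<and> norm (h\<^sub>s\<^sub>s \<omega>) \<le> C"
    and B4: "\<And>k. (C * exp (c * real k))-lipschitz_on UNIV (inv (\<sigma> 0) ^^ k)" "c < \<alpha> / (1 + \<zeta>)"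
    and \<Lambda>: "\<And>\<omega> j. operator_derivative I C \<zeta> i\<^sub>s\<^sub>s (\<lambda>g. \<psi> (i\<^sub>s g)) Ls
        (\<lambda>\<epsilon>. (inv (\<sigma> \<epsilon>) ^^ Suc j) \<omega>) (\<Lambda> \<omega> j)"
    and B6: "\<And>\<omega> j. norm (\<Lambda> \<omega> j) \<le> Q"
    and V: "V \<ge> 0"
  obtains B where "B \<ge> 0" "\<forall>\<epsilon>\<in>I. (\<forall>y. dist (inv (\<sigma> \<epsilon>) y) (inv (\<sigma> 0) y) \<le> V * \<bar>\<epsilon>\<bar>) \<longrightarrow> (\<forall>\<omega>\<in>\<Omega>\<^sub>e \<epsilon> \<inter> \<Omega>\<^sub>e 0.
      summable (\<lambda>j. i\<^sub>s (cocycle (\<sigma> 0) (\<lambda>\<omega>. Ls \<omega> 0) j ((inv (\<sigma> 0) ^^ j) \<omega>)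
                  (\<Lambda> \<omega> j (h\<^sub>s\<^sub>s ((inv (\<sigma> 0) ^^ Suc j) \<omega>))))) \<and>
      norm (i\<^sub>s (h \<epsilon> \<omega>) - i\<^sub>s (h 0 \<omega>) - \<epsilon> *\<^sub>R (\<Sum>j. i\<^sub>s (cocycle (\<sigma> 0) (\<lambda>\<omega>. Ls \<omega> 0) j
          ((inv (\<sigma> 0) ^^ j) \<omega>) (\<Lambda> \<omega> j (h\<^sub>s\<^sub>s ((inv (\<sigma> 0) ^^ Suc j) \<omega>))))))
        \<le> B * (\<bar>\<epsilon>\<bar> * (\<bar>\<epsilon>\<bar> powr \<zeta> + sqrt (\<bar>\<epsilon>\<bar> powr \<zeta>))))"
proof -
  interpret i\<^sub>s: bounded_linear i\<^sub>s by (rule embed_s)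
  interpret \<psi>: linear "blinfun_apply \<psi>"
    by (rule bounded_linear.linear[OF blinfun.bounded_linear_right])
  \<comment> \<open>A rate \<open>b\<close> strictly above \<open>max c 0\<close> absorbs the sum of the Lipschitz constants of the iterates,
    while \<open>b * (1 + \<zeta>) < \<alpha>\<close> keeps all error series convergent.\<close>
  have "max c 0 < \<alpha> / (1 + \<zeta>)" using B4(2) constants by auto
  then obtain b where b: "max c 0 < b" "b < \<alpha> / (1 + \<zeta>)" using dense by blast
  define a where "a = exp (- \<alpha>)"
  define \<beta> where "\<beta> = exp (b * (1 + \<zeta>))"
  \<comment> \<open>At time \<open>k\<close> the backward orbits are within
    \<open>W * \<bar>\<epsilon>\<bar> * exp b ^ k\<close> of each other. \<open>G\<close> will bound
    the operator derivatives applied to the unperturbed equilibria.\<close>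
  define W where "W = C / (exp b - 1) * V"
  define G where "G = Q * C"
  \<comment> \<open>The first summand bounds the remainder in the defect of the equilibria, the
    second the defect of the transported vectors; \<open>linear_response_estimate\<close> takes one
    constant for both. The extra factor \<beta> pays for orbit points of index
    \<open>Suc j\<close>.\<close>
  define M where "M = C\<^sup>2 * (1 + W powr (1 + \<zeta>)) * \<beta> + C * (W powr \<zeta> + 1) * \<beta> * (K * G)"
  define B where "B = C * M / (1 - a * \<beta>) + sqrt (2 * C\<^sup>2 * M * G / (1 - a * \<beta>)) / (1 - sqrt a)"
  have "b * (1 + \<zeta>) < \<alpha>" using b constants by (simp add: field_simps)
  then have a: "0 < a" "a < 1" "0 \<le> \<beta>" "a * \<beta> < 1" "1 \<le> \<beta>"
    using constants b by (auto simp: a_def \<beta>_def simp flip: exp_add)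
  have Q: "0 \<le> Q" using B6[of undefined 0] norm_ge_zero order_trans by blast
  have K: "0 \<le> K" if "\<omega> \<in> \<Omega>\<^sub>e 0" for \<omega>
    using B1[OF that, of 0] norm_ge_zero order_trans by blast
  have W: "0 \<le> W" using b V constants by (simp add: W_def)
  have G: "0 \<le> G" using Q constants by (simp add: G_def)
  show thesis
  \<comment> \<open>The sign of \<open>B\<close> is not known yet: \<open>K\<close> is seen to be
    nonnegative only once a point of \<open>\<Omega>\<^sub>e 0\<close> is given.\<close>
  proof (rule that[of "max B 0"], simp, intro ballI impI)
    fix \<epsilon> \<omega>
    assume \<epsilon>: "\<epsilon> \<in> I" and "\<forall>y. dist (inv (\<sigma> \<epsilon>) y) (inv (\<sigma> 0) y) \<le> V * \<bar>\<epsilon>\<bar>"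
      and "\<omega> \<in> \<Omega>\<^sub>e \<epsilon> \<inter> \<Omega>\<^sub>e 0"
    then have close: "dist (inv (\<sigma> \<epsilon>) y) (inv (\<sigma> 0) y) \<le> V * \<bar>\<epsilon>\<bar>"
      and \<omega>: "\<omega> \<in> \<Omega>\<^sub>e \<epsilon>" "\<omega> \<in> \<Omega>\<^sub>e 0" for y by auto
    define s where "s j = (inv (\<sigma> \<epsilon>) ^^ j) \<omega>" for j
    define t where "t j = (inv (\<sigma> 0) ^^ j) \<omega>" for j
    have inv: "\<sigma> \<epsilon> (inv (\<sigma> \<epsilon>) y) = y" if "\<epsilon> \<in> I" for \<epsilon> y
      using bij[OF that] by (simp add: bij_is_surj surj_f_inv_f)
    have s: "s j \<in> \<Omega>\<^sub>e \<epsilon>" and t: "t j \<in> \<Omega>\<^sub>e 0" for j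
      unfolding s_def t_def using \<epsilon> \<open>0 \<in> I\<close> \<omega> \<Omega>\<^sub>e bij by (auto intro: inverse_orbit_in_invariant_set)
    have s_Suc: "\<sigma> \<epsilon> (s (Suc j)) = s j" and t_Suc: "\<sigma> 0 (t (Suc j)) = t j" for j
      using inv \<epsilon> \<open>0 \<in> I\<close> by (simp_all add: s_def t_def)
    have K: "0 \<le> K" using K \<omega> by blast
    have M: "0 \<le> C\<^sup>2 * (1 + W powr (1 + \<zeta>)) * \<beta>" "0 \<le> C * (W powr \<zeta> + 1) * \<beta> * (K * G)"
      using constants a K G by auto
    then have "0 \<le> M" by (simp add: M_def)
    define \<eta> where "\<eta> = \<bar>\<epsilon>\<bar> powr \<zeta>"
    have \<eta>: "0 \<le> \<eta>" by (simp add: \<eta>_def)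
    have \<eta>': "\<bar>\<epsilon>\<bar> powr (1 + \<zeta>) = \<bar>\<epsilon>\<bar> * \<eta>" by (simp add: \<eta>_def powr_add)
    \<comment> \<open>Used with exponent 1 + \<zeta> for the remainder of the derivative and with
      \<zeta> for (A2). As \<open>b > 0\<close>, the rate \<beta> of the largest exponent covers
      both.\<close>
    have dist: "dist (s k) (t k) powr p \<le> W powr p * \<bar>\<epsilon>\<bar> powr p * \<beta> ^ k" if "0 < p" "p \<le> 1 + \<zeta>" for p k
    proof -
      have "dist (s k) (t k) \<le> C / (exp b - 1) * (V * \<bar>\<epsilon>\<bar>) * exp b ^ k"
        unfolding s_def t_def
        by (rule dist_funpow_perturbation_geometric[OF B4(1) close]) (use b constants in auto)
      also have "\<dots> = W * \<bar>\<epsilon>\<bar> * exp b ^ k" by (simp add: W_def)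
      finally have "dist (s k) (t k) powr p \<le> (W * \<bar>\<epsilon>\<bar> * exp b ^ k) powr p"
        using that by (intro powr_mono2) auto
      also have "\<dots> = W powr p * \<bar>\<epsilon>\<bar> powr p * exp (b * p) ^ k"
      proof -
        have "(exp b ^ k) powr p = exp (b * p) ^ k"
          by (simp add: powr_def ln_realpow mult_ac flip: exp_of_nat_mult)
        then show ?thesis by (simp add: powr_mult)
      qed
      also have "\<dots> \<le> W powr p * \<bar>\<epsilon>\<bar> powr p * \<beta> ^ k"
        unfolding \<beta>_def using that b by (intro mult_left_mono power_mono) auto
      finally show ?thesis .
    qed
    let ?A = "\<lambda>j. Lw (s (Suc j)) \<epsilon>" and ?B = "\<lambda>j. Lw (t (Suc j)) 0"
    let ?x = "\<lambda>j. i\<^sub>s (h \<epsilon> (s j))" and ?y = "\<lambda>j. i\<^sub>s (h 0 (t j))"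
    let ?gs = "\<lambda>j. \<Lambda> \<omega> j (h\<^sub>s\<^sub>s (t (Suc j)))"
    let ?g = "\<lambda>j. i\<^sub>s (?gs j)"
    \<comment> \<open>The vector \<open>?gs j\<close> carried from time \<open>j\<close> to time
      \<open>i\<close> by \<open>j - i\<close> unperturbed steps. The cocycle is taken on the strong
      space, since (A2) costs a strong norm and (B1) bounds exactly these products.\<close>
    let ?zs = "\<lambda>j i. cocycle (\<sigma> 0) (\<lambda>\<omega>. Ls \<omega> 0) (j - i) (t j) (?gs j)"
    have bwA: "backward_product ?A n = cocycle (\<sigma> \<epsilon>) (\<lambda>\<omega>. Lw \<omega> \<epsilon>) n (s n)" for n
      unfolding s_def using inv[OF \<epsilon>] by (simp add: cocycle_eq_backward_product)
    have bwB: "backward_product ?B n = cocycle (\<sigma> 0) (\<lambda>\<omega>. Lw \<omega> 0) n (t n)" for n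
      unfolding t_def using inv[OF \<open>0 \<in> I\<close>] by (simp add: cocycle_eq_backward_product)
    have cocycle_compat: "i\<^sub>s (cocycle (\<sigma> 0) (\<lambda>\<omega>. Ls \<omega> 0) n u g)
        = cocycle (\<sigma> 0) (\<lambda>\<omega>. Lw \<omega> 0) n u (i\<^sub>s g)" for n u g
      by (induction n) (simp_all add: L_compat[OF \<open>0 \<in> I\<close>])
    have gs: "norm (?gs j) \<le> G" for j
    proof -
      have "norm (?gs j) \<le> norm (\<Lambda> \<omega> j) * norm (h\<^sub>s\<^sub>s (t (Suc j)))" by (rule norm_blinfun)
      also have "\<dots> \<le> Q * C" using B6 B2[OF t] Q by (intro mult_mono) auto
      finally show ?thesis by (simp add: G_def)
    qed
    \<comment> \<open>The curve differentiated by \<open>\<Lambda> \<omega> j\<close> passes through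
      \<open>s (Suc j)\<close> at \<epsilon> and through \<open>t (Suc j)\<close> at 0.\<close>
    have \<Lambda>D: "\<psi> (i\<^sub>s (\<Lambda> \<omega> j g)) = 0"
      "norm (Ls (s (Suc j)) \<epsilon> (i\<^sub>s\<^sub>s g) - Ls (t (Suc j)) 0 (i\<^sub>s\<^sub>s g) - \<epsilon> *\<^sub>R \<Lambda> \<omega> j g)
        \<le> C * (\<bar>\<epsilon>\<bar> powr (1 + \<zeta>) + dist (s (Suc j)) (t (Suc j)) powr (1 + \<zeta>)) * norm g" for j g
      using \<Lambda>[of j \<omega>] \<epsilon> unfolding operator_derivative_def s_def t_def by blast+
    have equilibrium: "Ls (t (Suc j)) 0 (h 0 (t (Suc j))) = h 0 (t j)" for j
      using A4[OF \<open>0 \<in> I\<close> t[of "Suc j"]] by (simp add: t_Suc)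
    have R: "norm (?A j (?y (Suc j)) - ?y j - \<epsilon> *\<^sub>R ?g j) \<le> M * \<beta> ^ j * (\<bar>\<epsilon>\<bar> * \<eta>)" for j
    proof -
      have "?A j (?y (Suc j)) - ?y j - \<epsilon> *\<^sub>R ?g j = i\<^sub>s (Ls (s (Suc j)) \<epsilon> (i\<^sub>s\<^sub>s (h\<^sub>s\<^sub>s (t (Suc j))))
          - Ls (t (Suc j)) 0 (i\<^sub>s\<^sub>s (h\<^sub>s\<^sub>s (t (Suc j)))) - \<epsilon> *\<^sub>R ?gs j)"
        using B2[OF t[of "Suc j"]] by (simp add: i\<^sub>s.diff i\<^sub>s.scaleR L_compat[OF \<epsilon>] equilibrium)
      also have "norm \<dots> \<le> norm (Ls (s (Suc j)) \<epsilon> (i\<^sub>s\<^sub>s (h\<^sub>s\<^sub>s (t (Suc j))))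
          - Ls (t (Suc j)) 0 (i\<^sub>s\<^sub>s (h\<^sub>s\<^sub>s (t (Suc j)))) - \<epsilon> *\<^sub>R ?gs j)"
        by (rule embed_s)
      also have "\<dots> \<le> C * (\<bar>\<epsilon>\<bar> powr (1 + \<zeta>) + dist (s (Suc j)) (t (Suc j)) powr (1 + \<zeta>))
          * norm (h\<^sub>s\<^sub>s (t (Suc j)))"
        by (rule \<Lambda>D)
      \<comment> \<open>The term without orbit growth is padded by a power of
        \<open>\<beta> \<ge> 1\<close>, so that both terms share one geometric rate.\<close>
      also have "\<dots> \<le> C * (\<bar>\<epsilon>\<bar> powr (1 + \<zeta>) * \<beta> ^ Suc j
          + W powr (1 + \<zeta>) * \<bar>\<epsilon>\<bar> powr (1 + \<zeta>) * \<beta> ^ Suc j) * C"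
      proof (intro mult_mono add_mono)
        show "\<bar>\<epsilon>\<bar> powr (1 + \<zeta>) \<le> \<bar>\<epsilon>\<bar> powr (1 + \<zeta>) * \<beta> ^ Suc j"
          using mult_left_mono[OF one_le_power[OF a(5), of "Suc j"], of "\<bar>\<epsilon>\<bar> powr (1 + \<zeta>)"] by simp
        show "dist (s (Suc j)) (t (Suc j)) powr (1 + \<zeta>)
            \<le> W powr (1 + \<zeta>) * \<bar>\<epsilon>\<bar> powr (1 + \<zeta>) * \<beta> ^ Suc j"
          using constants by (intro dist) auto
        show "norm (h\<^sub>s\<^sub>s (t (Suc j))) \<le> C" using B2[OF t] by simp
      qed (use constants a in auto)
      also have "\<dots> = C\<^sup>2 * (1 + W powr (1 + \<zeta>)) * \<beta> * (\<beta> ^ j * (\<bar>\<epsilon>\<bar> * \<eta>))"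
        unfolding \<eta>' by (simp add: power2_eq_square algebra_simps)
      also have "\<dots> \<le> M * (\<beta> ^ j * (\<bar>\<epsilon>\<bar> * \<eta>))"
        using M a \<eta> by (intro mult_right_mono) (auto simp: M_def)
      finally show ?thesis by (simp add: mult.assoc)
    qed
    have Z: "?B i (i\<^sub>s (?zs j (Suc i))) = i\<^sub>s (?zs j i)" if "i < j" for i j
    proof -
      \<comment> \<open>The last of the \<open>j - i\<close> operators in \<open>?zs j i\<close>
        acts at the point reached after \<open>j - Suc i\<close> steps, and this is where
        \<open>?B i\<close> is based.\<close>
      have "(\<sigma> 0 ^^ (j - Suc i)) (t j) = t (Suc i)"
        unfolding t_def using funpow_cancel[of "\<sigma> 0" "inv (\<sigma> 0)" "j - Suc i" "Suc i" \<omega>]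
          inv[OF \<open>0 \<in> I\<close>] that by simp
      then show ?thesis
        using that by (simp add: Suc_diff_Suc[symmetric] L_compat[OF \<open>0 \<in> I\<close>])
    qed
    have Zbound: "norm (?A i (i\<^sub>s (?zs j (Suc i))) - i\<^sub>s (?zs j i)) \<le> M * \<beta> ^ i * \<eta>" if "i < j" for i j
    proof -
      have zs: "norm (?zs j (Suc i)) \<le> K * G"
        using norm_blinfun[of "cocycle (\<sigma> 0) (\<lambda>\<omega>. Ls \<omega> 0) (j - Suc i) (t j)" "?gs j"]
          mult_mono[OF B1[OF t[of j], of "j - Suc i"] gs[of j] K norm_ge_zero] by linarith
      \<comment> \<open>By \<open>Z\<close>, \<open>?zs j i\<close> is the image of
        \<open>?zs j (Suc i)\<close> under \<open>?B i\<close>, so the defect is a difference of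
        operators. (A2) yields only the small factor \<eta>, without an additional
        \<epsilon>.\<close>
      have "norm (?A i (i\<^sub>s (?zs j (Suc i))) - ?B i (i\<^sub>s (?zs j (Suc i))))
          \<le> C * (dist (s (Suc i)) (t (Suc i)) powr \<zeta> + \<eta>) * norm (?zs j (Suc i))"
        unfolding \<eta>_def by (rule A2[OF \<epsilon> s t])
      also have "\<dots> \<le> C * (W powr \<zeta> * \<eta> * \<beta> ^ Suc i + \<eta> * \<beta> ^ Suc i) * (K * G)"
      proof (intro mult_mono add_mono zs)
        show "dist (s (Suc i)) (t (Suc i)) powr \<zeta> \<le> W powr \<zeta> * \<eta> * \<beta> ^ Suc i"
          unfolding \<eta>_def using constants by (intro dist) auto
        show "\<eta> \<le> \<eta> * \<beta> ^ Suc i"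
          using mult_left_mono[OF one_le_power[OF a(5), of "Suc i"] \<eta>] by simp
      qed (use constants \<eta> a in auto)
      also have "\<dots> = C * (W powr \<zeta> + 1) * \<beta> * (K * G) * (\<beta> ^ i * \<eta>)"
        by (simp add: algebra_simps)
      also have "\<dots> \<le> M * (\<beta> ^ i * \<eta>)"
        using M a \<eta> by (intro mult_right_mono) (auto simp: M_def)
      finally show ?thesis using Z[OF that] by (simp add: mult.assoc)
    qed
    have decay: "exp (- \<alpha> * real n) = a ^ n" for n
      by (simp add: a_def flip: exp_of_nat2_mult)
    have xy: "\<psi> (?x j) = 1" "\<psi> (?y j) = 1" "norm (?x j - ?y j) \<le> 2 * C" for j
    proof -
      show "\<psi> (?x j) = 1" "\<psi> (?y j) = 1" using A3 s t \<epsilon> \<open>0 \<in> I\<close> by auto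
      have "norm (?x j) \<le> C" "norm (?y j) \<le> C"
        using A3 s t \<epsilon> \<open>0 \<in> I\<close> embed_s(2) order_trans by blast+
      then show "norm (?x j - ?y j) \<le> 2 * C" using norm_triangle_ineq4[of "?x j" "?y j"] by linarith
    qed
    have x: "?A j (?x (Suc j)) = ?x j" for j
      using A4[OF \<epsilon> s[of "Suc j"]] by (simp add: s_Suc flip: L_compat[OF \<epsilon>])
    have A1': "norm (backward_product ?A n v) \<le> C * a ^ n * norm v"
        "norm (backward_product ?B n v) \<le> C * a ^ n * norm v" if "\<psi> v = 0" for n v
      unfolding bwA bwB decay[symmetric] by (rule A1[OF \<epsilon> s that], rule A1[OF \<open>0 \<in> I\<close> t that])
    have g0: "\<psi> (?g j) = 0" for j by (rule \<Lambda>D)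
    have gG: "norm (?g j) \<le> G" for j using embed_s(2) gs order_trans by blast
    have zg: "i\<^sub>s (?zs j j) = ?g j" for j by simp
    note estimate = linear_response_estimate[of a \<beta> C M \<eta> G "blinfun_apply \<psi>" ?A ?B ?x 1 ?y "2 * C" ?g \<epsilon>
        "\<lambda>j i. i\<^sub>s (?zs j i)", OF a(1-4) _ \<open>0 \<le> M\<close> \<eta> G \<psi>.linear_axioms L_\<psi>[OF \<epsilon>] L_\<psi>[OF \<open>0 \<in> I\<close>]
        A1' x xy g0 gG R zg Z Zbound]
    have series: "i\<^sub>s (cocycle (\<sigma> 0) (\<lambda>\<omega>. Ls \<omega> 0) j ((inv (\<sigma> 0) ^^ j) \<omega>)
                  (\<Lambda> \<omega> j (h\<^sub>s\<^sub>s ((inv (\<sigma> 0) ^^ Suc j) \<omega>)))) = backward_product ?B j (?g j)" for j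
      by (simp only: cocycle_compat t_def bwB[unfolded t_def])
    have "norm (?x 0 - ?y 0 - \<epsilon> *\<^sub>R (\<Sum>j. backward_product ?B j (?g j)))
      \<le> \<bar>\<epsilon>\<bar> * (C * M * \<eta> / (1 - a * \<beta>) + sqrt (2 * C\<^sup>2 * M * G / (1 - a * \<beta>)) * sqrt \<eta> / (1 - sqrt a))"
      by (rule estimate(1)) (use constants in auto)
    also have "\<dots> \<le> \<bar>\<epsilon>\<bar> * (B * (\<eta> + sqrt \<eta>))"
    proof (rule mult_left_mono)
      \<comment> \<open>Expanding \<open>B * (\<eta> + sqrt \<eta>)\<close> gives the two wanted
        terms and two cross terms, which are nonnegative.\<close>
      have p: "0 \<le> C * M / (1 - a * \<beta>)" "0 \<le> sqrt (2 * C\<^sup>2 * M * G / (1 - a * \<beta>)) / (1 - sqrt a)"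
        using constants \<open>0 \<le> M\<close> a G by auto
      show "C * M * \<eta> / (1 - a * \<beta>) + sqrt (2 * C\<^sup>2 * M * G / (1 - a * \<beta>)) * sqrt \<eta> / (1 - sqrt a)
          \<le> B * (\<eta> + sqrt \<eta>)"
        using mult_nonneg_nonneg[OF p(1), of "sqrt \<eta>"] mult_nonneg_nonneg[OF p(2) \<eta>] \<eta>
        unfolding B_def by (simp only: distrib_left distrib_right times_divide_eq_left) simp
    qed simp
    also have "\<dots> \<le> \<bar>\<epsilon>\<bar> * (max B 0 * (\<eta> + sqrt \<eta>))"
      using \<eta> by (intro mult_left_mono mult_right_mono) auto
    finally show "summable (\<lambda>j. i\<^sub>s (cocycle (\<sigma> 0) (\<lambda>\<omega>. Ls \<omega> 0) j ((inv (\<sigma> 0) ^^ j) \<omega>)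
                  (\<Lambda> \<omega> j (h\<^sub>s\<^sub>s ((inv (\<sigma> 0) ^^ Suc j) \<omega>))))) \<and>
      norm (i\<^sub>s (h \<epsilon> \<omega>) - i\<^sub>s (h 0 \<omega>) - \<epsilon> *\<^sub>R (\<Sum>j. i\<^sub>s (cocycle (\<sigma> 0) (\<lambda>\<omega>. Ls \<omega> 0) j
          ((inv (\<sigma> 0) ^^ j) \<omega>) (\<Lambda> \<omega> j (h\<^sub>s\<^sub>s ((inv (\<sigma> 0) ^^ Suc j) \<omega>))))))
        \<le> max B 0 * (\<bar>\<epsilon>\<bar> * (\<bar>\<epsilon>\<bar> powr \<zeta> + sqrt (\<bar>\<epsilon>\<bar> powr \<zeta>)))"
      unfolding series using estimate(2) constants
      by (simp add: s_def t_def \<eta>_def mult_ac)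
  qed
qed

section \<open>Disintegration along a kernel\<close>

text \<open>The measure built from \<open>P\<close> and \<kappa> by monadic bind has iterated
  integrals by construction. It agrees with \<mu> on rectangles, which form an intersection-stable
  generator, so the two measures coincide.\<close>

lemma nn_integral_disintegration:
  fixes P :: "'a measure" and \<mu> :: "('a \<times> 'b) measure"
  assumes "prob_space P" and \<kappa>[measurable]: "\<kappa> \<in> P \<rightarrow>\<^sub>M prob_algebra N"
    and sets_\<mu>: "sets \<mu> = sets (P \<Otimes>\<^sub>M N)"
    and \<mu>: "\<And>S B. S \<in> sets P \<Longrightarrow> B \<in> sets N \<Longrightarrow>
        emeasure \<mu> (S \<times> B) = (\<integral>\<^sup>+\<omega>\<in>S. emeasure (\<kappa> \<omega>) B \<partial>P)"
    and f: "f \<in> borel_measurable (P \<Otimes>\<^sub>M N)"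
  shows "(\<integral>\<^sup>+z. f z \<partial>\<mu>) = (\<integral>\<^sup>+\<omega>. \<integral>\<^sup>+x. f (\<omega>, x) \<partial>\<kappa> \<omega> \<partial>P)"
proof -
  interpret prob_space P by fact
  \<comment> \<open>The law of the pair (\<omega>, x) for a fixed \<omega> and \<open>x\<close>
    distributed by \<open>\<kappa> \<omega>\<close>.\<close>
  let ?J = "\<lambda>\<omega>. \<kappa> \<omega> \<bind> (\<lambda>x. return (P \<Otimes>\<^sub>M N) (\<omega>, x))"
  have [measurable]: "\<kappa> \<in> P \<rightarrow>\<^sub>M subprob_algebra N"
    using \<kappa> by (rule measurable_prob_algebraD)
  have J_meas[measurable]: "?J \<in> P \<rightarrow>\<^sub>M subprob_algebra (P \<Otimes>\<^sub>M N)"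
    by measurable
  have sets_\<kappa>: "sets (\<kappa> \<omega>) = sets N" if "\<omega> \<in> space P" for \<omega>
    using subprob_measurableD(2)[OF \<open>\<kappa> \<in> P \<rightarrow>\<^sub>M subprob_algebra N\<close> that] .
  have nn: "(\<integral>\<^sup>+z. g z \<partial>(P \<bind> ?J)) = (\<integral>\<^sup>+\<omega>. \<integral>\<^sup>+x. g (\<omega>, x) \<partial>\<kappa> \<omega> \<partial>P)"
    if g[measurable]: "g \<in> borel_measurable (P \<Otimes>\<^sub>M N)" for g :: "'a \<times> 'b \<Rightarrow> ennreal"
  proof -
    have "(\<integral>\<^sup>+z. g z \<partial>(P \<bind> ?J)) = (\<integral>\<^sup>+\<omega>. \<integral>\<^sup>+z. g z \<partial>?J \<omega> \<partial>P)"
      by (rule nn_integral_bind) measurable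
    also have "\<dots> = (\<integral>\<^sup>+\<omega>. \<integral>\<^sup>+x. g (\<omega>, x) \<partial>\<kappa> \<omega> \<partial>P)"
    proof (rule nn_integral_cong)
      fix \<omega> assume \<omega>: "\<omega> \<in> space P"
      have "(\<lambda>x. return (P \<Otimes>\<^sub>M N) (\<omega>, x)) \<in> N \<rightarrow>\<^sub>M subprob_algebra (P \<Otimes>\<^sub>M N)"
        using \<omega> by measurable
      then have J: "(\<lambda>x. return (P \<Otimes>\<^sub>M N) (\<omega>, x)) \<in> \<kappa> \<omega> \<rightarrow>\<^sub>M subprob_algebra (P \<Otimes>\<^sub>M N)"
        by (simp add: measurable_cong_sets[OF sets_\<kappa>[OF \<omega>]])
      have "(\<integral>\<^sup>+z. g z \<partial>?J \<omega>) = (\<integral>\<^sup>+x. \<integral>\<^sup>+z. g z \<partial>return (P \<Otimes>\<^sub>M N) (\<omega>, x) \<partial>\<kappa> \<omega>)"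
        by (rule nn_integral_bind[OF g J])
      also have "\<dots> = (\<integral>\<^sup>+x. g (\<omega>, x) \<partial>\<kappa> \<omega>)"
        using \<omega> sets_eq_imp_space_eq[OF sets_\<kappa>[OF \<omega>]]
        by (intro nn_integral_cong nn_integral_return) (auto simp: space_pair_measure)
      finally show "(\<integral>\<^sup>+z. g z \<partial>?J \<omega>) = (\<integral>\<^sup>+x. g (\<omega>, x) \<partial>\<kappa> \<omega>)" .
    qed
    finally show ?thesis .
  qed
  have sets_bind': "sets (P \<bind> ?J) = sets (P \<Otimes>\<^sub>M N)"
    by (rule sets_bind[OF subprob_measurableD(2)[OF J_meas] not_empty])
  have "\<mu> = P \<bind> ?J"
  proof (rule measure_eqI_generator_eq[OF Int_stable_pair_measure_generator[of P N]])
    show "{a \<times> b |a b. a \<in> sets P \<and> b \<in> sets N} \<subseteq> Pow (space P \<times> space N)"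
      by (auto dest: sets.sets_into_space)
    show "sets \<mu> = sigma_sets (space P \<times> space N) {a \<times> b |a b. a \<in> sets P \<and> b \<in> sets N}"
      "sets (P \<bind> ?J) = sigma_sets (space P \<times> space N) {a \<times> b |a b. a \<in> sets P \<and> b \<in> sets N}"
      unfolding sets_\<mu> sets_bind' sets_pair_measure by rule+
    show "range (\<lambda>_::nat. space P \<times> space N) \<subseteq> {a \<times> b |a b. a \<in> sets P \<and> b \<in> sets N}"
      "(\<Union>i::nat. space P \<times> space N) = space P \<times> space N"
      by auto
    \<comment> \<open>Uniqueness from a generator needs a cover by sets of finite measure; here the
      whole space is one, the kernel being made of probability measures.\<close>
    have "emeasure (\<kappa> \<omega>) (space N) = 1" if "\<omega> \<in> space P" for \<omega>
      using measurable_space[OF \<kappa> that] prob_space.emeasure_space_1[of "\<kappa> \<omega>"]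
        sets_eq_imp_space_eq[OF sets_\<kappa>[OF that]] by (simp add: space_prob_algebra)
    then have "emeasure \<mu> (space P \<times> space N) = (\<integral>\<^sup>+\<omega>. 1 \<partial>P)"
      unfolding \<mu>[OF sets.top sets.top] by (intro nn_integral_cong) auto
    then show "emeasure \<mu> (space P \<times> space N) \<noteq> \<infinity>" by (simp add: emeasure_space_1)
    fix X assume "X \<in> {a \<times> b |a b. a \<in> sets P \<and> b \<in> sets N}"
    then obtain S B where X: "X = S \<times> B" and [measurable]: "S \<in> sets P" "B \<in> sets N" by blast
    have "emeasure (P \<bind> ?J) X = (\<integral>\<^sup>+z. indicator X z \<partial>(P \<bind> ?J))"
      by (simp add: X sets_bind')
    also have "\<dots> = (\<integral>\<^sup>+\<omega>. \<integral>\<^sup>+x. indicator X (\<omega>, x) \<partial>\<kappa> \<omega> \<partial>P)"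
      unfolding X by (rule nn) measurable
    also have "\<dots> = (\<integral>\<^sup>+\<omega>\<in>S. emeasure (\<kappa> \<omega>) B \<partial>P)"
      by (intro nn_integral_cong) (simp add: X indicator_times sets_\<kappa> nn_integral_cmult mult.commute)
    finally show "emeasure \<mu> X = emeasure (P \<bind> ?J) X" unfolding X by (simp add: \<mu>)
  qed
  then show ?thesis using nn[OF f] by simp
qed

text \<open>Pushing \<open>\<kappa> \<omega>\<close> forward along \<open>Pair \<omega>\<close>
  moves the dependence on \<omega> from the integrand into the measure, where measurability of
  integration over a subprobability kernel applies.\<close>

lemma integral_measurable_kernel:
  fixes f :: "'a \<times> 'b \<Rightarrow> real"
  assumes \<kappa>[measurable]: "\<kappa> \<in> P \<rightarrow>\<^sub>M subprob_algebra N"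
    and f[measurable]: "f \<in> borel_measurable (P \<Otimes>\<^sub>M N)"
  shows "(\<lambda>\<omega>. \<integral>x. f (\<omega>, x) \<partial>\<kappa> \<omega>) \<in> borel_measurable P"
proof -
  have "(\<lambda>\<omega>. distr (\<kappa> \<omega>) (P \<Otimes>\<^sub>M N) (Pair \<omega>)) \<in> P \<rightarrow>\<^sub>M subprob_algebra (P \<Otimes>\<^sub>M N)"
    by (rule measurable_distr2[OF _ \<kappa>]) measurable
  from measurable_compose[OF this integral_measurable_subprob_algebra[OF f]]
  have "(\<lambda>\<omega>. \<integral>z. f z \<partial>distr (\<kappa> \<omega>) (P \<Otimes>\<^sub>M N) (Pair \<omega>)) \<in> borel_measurable P" .
  moreover have "(\<integral>z. f z \<partial>distr (\<kappa> \<omega>) (P \<Otimes>\<^sub>M N) (Pair \<omega>)) = (\<integral>x. f (\<omega>, x) \<partial>\<kappa> \<omega>)"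
    if \<omega>: "\<omega> \<in> space P" for \<omega>
  proof -
    have "Pair \<omega> \<in> N \<rightarrow>\<^sub>M P \<Otimes>\<^sub>M N" using \<omega> by measurable
    then have "Pair \<omega> \<in> \<kappa> \<omega> \<rightarrow>\<^sub>M P \<Otimes>\<^sub>M N"
      by (simp add: measurable_cong_sets[OF subprob_measurableD(2)[OF \<kappa> \<omega>]])
    then show ?thesis
      by (rule integral_distr) (rule f)
  qed
  ultimately show ?thesis by (subst (asm) measurable_cong)
qed

text \<open>The fibrewise bound makes \<open>f\<close> integrable for \<mu> and on almost every
  fibre. The nonnegative case then applies to the positive and negative parts, whose fibre integrals
  are finite and may be subtracted.\<close>

lemma integral_disintegration:
  fixes P :: "'a measure" and \<mu> :: "('a \<times> 'b) measure" and f :: "'a \<times> 'b \<Rightarrow> real"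
  assumes P: "prob_space P" and \<kappa>: "\<kappa> \<in> P \<rightarrow>\<^sub>M prob_algebra N"
    and sets_\<mu>: "sets \<mu> = sets (P \<Otimes>\<^sub>M N)"
    and \<mu>: "\<And>S B. S \<in> sets P \<Longrightarrow> B \<in> sets N \<Longrightarrow>
        emeasure \<mu> (S \<times> B) = (\<integral>\<^sup>+\<omega>\<in>S. emeasure (\<kappa> \<omega>) B \<partial>P)"
    and f[measurable]: "f \<in> borel_measurable (P \<Otimes>\<^sub>M N)"
    and bound: "AE \<omega> in P. (\<integral>\<^sup>+x. ennreal \<bar>f (\<omega>, x)\<bar> \<partial>\<kappa> \<omega>) \<le> ennreal B"
  shows "integrable P (\<lambda>\<omega>. \<integral>x. f (\<omega>, x) \<partial>\<kappa> \<omega>)"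
    and "(\<integral>z. f z \<partial>\<mu>) = (\<integral>\<omega>. \<integral>x. f (\<omega>, x) \<partial>\<kappa> \<omega> \<partial>P)"
proof -
  interpret prob_space P by fact
  note \<kappa>' = measurable_prob_algebraD[OF \<kappa>]
  note [measurable] = \<kappa>'
  note dis = nn_integral_disintegration[OF P \<kappa> sets_\<mu> \<mu>]
  have f_\<mu>: "f \<in> borel_measurable \<mu>"
    using f by (simp add: measurable_cong_sets[OF sets_\<mu>])
  have "(\<integral>\<^sup>+z. ennreal (norm (f z)) \<partial>\<mu>) = (\<integral>\<^sup>+\<omega>. \<integral>\<^sup>+x. ennreal \<bar>f (\<omega>, x)\<bar> \<partial>\<kappa> \<omega> \<partial>P)"
    by (subst dis) auto
  also have "\<dots> \<le> (\<integral>\<^sup>+\<omega>. ennreal B \<partial>P)"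
    using bound by (rule nn_integral_mono_AE)
  also have "\<dots> < \<infinity>" by (simp add: emeasure_space_1)
  finally have int_\<mu>: "integrable \<mu> f" using f_\<mu> by (simp add: integrable_iff_bounded)
  \<comment> \<open>For \<open>s = 1\<close> and \<open>s = -1\<close> these are the fibre integrals
    of the positive and negative part, since \<open>ennreal\<close> sends negative reals to
    0.\<close>
  let ?u = "\<lambda>s \<omega>. \<integral>\<^sup>+x. ennreal (s * f (\<omega>, x)) \<partial>\<kappa> \<omega>"
  have u_meas[measurable]: "?u s \<in> borel_measurable P" for s
    by (rule nn_integral_measurable_subprob_algebra2[where N = N]) measurable
  have u_bound: "AE \<omega> in P. ?u s \<omega> \<le> ennreal B" if "\<bar>s\<bar> = 1" for s
    using bound
  proof eventually_elim
    case (elim \<omega>)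
    have "?u s \<omega> \<le> (\<integral>\<^sup>+x. ennreal \<bar>f (\<omega>, x)\<bar> \<partial>\<kappa> \<omega>)"
    proof (intro nn_integral_mono ennreal_leI)
      show "s * f (\<omega>, x) \<le> \<bar>f (\<omega>, x)\<bar>" for x
        using abs_ge_self[of "s * f (\<omega>, x)"] that by (simp add: abs_mult)
    qed
    then show ?case using elim by (rule order_trans)
  qed
  have u_int: "integrable P (\<lambda>\<omega>. enn2real (?u s \<omega>))"
      "(\<integral>\<omega>. enn2real (?u s \<omega>) \<partial>P) = enn2real (\<integral>\<^sup>+z. ennreal (s * f z) \<partial>\<mu>)" if "\<bar>s\<bar> = 1" for s
  proof -
    show "integrable P (\<lambda>\<omega>. enn2real (?u s \<omega>))"
    \<comment> \<open>No sign of \<open>B\<close> is assumed; for negative \<open>B\<close> the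
      value \<open>ennreal B\<close> is 0.\<close>
    proof (rule integrable_const_bound[where B = "max B 0"])
      show "AE \<omega> in P. norm (enn2real (?u s \<omega>)) \<le> max B 0"
        using u_bound[OF that]
      proof eventually_elim
        case (elim \<omega>)
        then show ?case using enn2real_mono[OF elim] by (auto simp: enn2real_ennreal max_def ennreal_neg split: if_splits)
      qed
    qed measurable
    have "(\<integral>\<omega>. enn2real (?u s \<omega>) \<partial>P) = enn2real (\<integral>\<^sup>+\<omega>. ennreal (enn2real (?u s \<omega>)) \<partial>P)"
      by (rule integral_eq_nn_integral) auto
    also have "(\<integral>\<^sup>+\<omega>. ennreal (enn2real (?u s \<omega>)) \<partial>P) = (\<integral>\<^sup>+\<omega>. ?u s \<omega> \<partial>P)"
    proof (rule nn_integral_cong_AE)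
      show "AE \<omega> in P. ennreal (enn2real (?u s \<omega>)) = ?u s \<omega>"
        using u_bound[OF that] by eventually_elim (metis ennreal_enn2real ennreal_less_top le_less_trans)
    qed
    also have "\<dots> = (\<integral>\<^sup>+z. ennreal (s * f z) \<partial>\<mu>)"
      by (subst dis) auto
    finally show "(\<integral>\<omega>. enn2real (?u s \<omega>) \<partial>P) = enn2real (\<integral>\<^sup>+z. ennreal (s * f z) \<partial>\<mu>)" .
  qed
  have fiber: "AE \<omega> in P. enn2real (?u 1 \<omega>) - enn2real (?u (-1) \<omega>) = (\<integral>x. f (\<omega>, x) \<partial>\<kappa> \<omega>)"
    using bound AE_space
  proof eventually_elim
    case (elim \<omega>)
    have "(\<lambda>x. f (\<omega>, x)) \<in> borel_measurable N" using elim(2) by measurable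
    then have "(\<lambda>x. f (\<omega>, x)) \<in> borel_measurable (\<kappa> \<omega>)"
      by (simp add: measurable_cong_sets[OF subprob_measurableD(2)[OF \<kappa>' elim(2)]])
    moreover have "(\<integral>\<^sup>+x. ennreal \<bar>f (\<omega>, x)\<bar> \<partial>\<kappa> \<omega>) < \<infinity>"
      using elim(1) by (rule le_less_trans) simp
    ultimately have "integrable (\<kappa> \<omega>) (\<lambda>x. f (\<omega>, x))"
      by (simp add: integrable_iff_bounded)
    then show ?case by (simp add: real_lebesgue_integral_def)
  qed
  have kernel_meas: "(\<lambda>\<omega>. \<integral>x. f (\<omega>, x) \<partial>\<kappa> \<omega>) \<in> borel_measurable P"
    using \<kappa>' f by (rule integral_measurable_kernel)
  have diff_meas: "(\<lambda>\<omega>. enn2real (?u 1 \<omega>) - enn2real (?u (-1) \<omega>)) \<in> borel_measurable P"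
    by (intro borel_measurable_diff measurable_compose[OF u_meas]) measurable
  have diff_int: "integrable P (\<lambda>\<omega>. enn2real (?u 1 \<omega>) - enn2real (?u (-1) \<omega>))"
    by (intro Bochner_Integration.integrable_diff u_int(1)) auto
  then show "integrable P (\<lambda>\<omega>. \<integral>x. f (\<omega>, x) \<partial>\<kappa> \<omega>)"
    by (rule integrable_cong_AE_imp[OF _ kernel_meas]) (rule fiber)
  have "(\<integral>\<omega>. \<integral>x. f (\<omega>, x) \<partial>\<kappa> \<omega> \<partial>P) = (\<integral>\<omega>. enn2real (?u 1 \<omega>) - enn2real (?u (-1) \<omega>) \<partial>P)"
    by (rule integral_cong_AE[OF kernel_meas diff_meas AE_symmetric[OF fiber]])
  also have "\<dots> = (\<integral>\<omega>. enn2real (?u 1 \<omega>) \<partial>P) - (\<integral>\<omega>. enn2real (?u (-1) \<omega>) \<partial>P)"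
    by (intro Bochner_Integration.integral_diff u_int(1)) auto
  also have "\<dots> = (\<integral>z. f z \<partial>\<mu>)"
    using u_int(2)[of 1] u_int(2)[of "-1"] int_\<mu> by (simp add: real_lebesgue_integral_def)
  finally show "(\<integral>z. f z \<partial>\<mu>) = (\<integral>\<omega>. \<integral>x. f (\<omega>, x) \<partial>\<kappa> \<omega> \<partial>P)" ..
qed

section \<open>Pairings with test functions\<close>

text \<open>The value \<open>f x\<close> is the derivative of order zero in a chart piece containing
  \<open>x\<close>. The real supremum dominates it because the set is bounded: there are finitely
  many multi-indices and pieces, and each derivative is continuous on a compact image.\<close>

lemma norm_le_Cr_norm:
  fixes A :: "('x::topological_space, 'n::finite) chart set"
  assumes A: "smooth_atlas A" and N: "chart_cover A N" and f: "f \<in> Cr_manifold A r"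
  shows "norm (f x) \<le> Cr_norm N r f"
proof -
  let ?v = "\<lambda>is c p. norm (iter_partial is (f \<circ> chart_inv c) (snd c p))"
  let ?S = "{?v is c p | is c K p. length is \<le> r \<and> (c, K) \<in> N \<and> p \<in> K}"
  have "bdd_above (?v is c ` K)" if "length is \<le> r" "(c, K) \<in> N" for "is" c K
  proof -
    have c: "c \<in> A" "compact K" "K \<subseteq> fst c" using N that by (auto simp: chart_cover_def)
    have "continuous_on (fst c) (snd c)"
      using A c(1) by (auto simp: smooth_atlas_def homeomorphism_def)
    then have "compact (snd c ` K)"
      using c by (metis compact_continuous_image continuous_on_subset)
    moreover have "continuous_on (snd c ` fst c) (iter_partial is (f \<circ> chart_inv c))"
      using f c(1) that(1) by (auto simp: Cr_manifold_def Ck_on_def)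
    then have "continuous_on (snd c ` K) (iter_partial is (f \<circ> chart_inv c))"
      by (rule continuous_on_subset) (use c in auto)
    ultimately have "bounded (iter_partial is (f \<circ> chart_inv c) ` snd c ` K)"
      by (intro compact_imp_bounded[OF compact_continuous_image])
    then obtain b where "norm y \<le> b" if "y \<in> iter_partial is (f \<circ> chart_inv c) ` snd c ` K" for y
      unfolding bounded_iff by blast
    then show ?thesis by (intro bdd_aboveI2[of _ _ b]) blast
  qed
  moreover have "?S = (\<Union>(is, c, K)\<in>{is. set is \<subseteq> UNIV \<and> length is \<le> r} \<times> N. ?v is c ` K)"
    by fastforce
  moreover have "finite ({is :: 'n list. set is \<subseteq> UNIV \<and> length is \<le> r} \<times> N)"
    using N by (intro finite_cartesian_product finite_lists_length_le) (auto simp: chart_cover_def)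
  ultimately have bdd: "bdd_above ?S" by (auto intro!: bdd_above_UN[THEN iffD2])
  have "x \<in> (\<Union>(c, K)\<in>N. K)" using N by (simp add: chart_cover_def)
  then obtain c K where cK: "(c, K) \<in> N" "x \<in> K" by auto
  then have c: "c \<in> A" "x \<in> fst c" using N by (auto simp: chart_cover_def)
  then have "homeomorphism (fst c) (snd c ` fst c) (snd c) (chart_inv c)"
    using A by (simp add: smooth_atlas_def)
  then have "chart_inv c (snd c x) = x" using c(2) by (rule homeomorphism_apply1)
  then have "norm (f x) = ?v [] c x" by simp
  moreover have "?v [] c x \<in> ?S" using cK by fastforce
  ultimately show ?thesis unfolding Cr_norm_def using cSup_upper[OF _ bdd] by simp
qed

text \<open>Together with \<open>test_norm\<close>, this treats cases (E) and (H) at once: it is the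
  condition on the fibres of \<Phi>, and \<open>test_norm\<close> of the fibre over \<omega> is
  \<theta>(\<omega>).\<close>

definition test_function ::
    "bool \<Rightarrow> 'm measure \<Rightarrow> ('m::topological_space, 'k::finite) chart set \<Rightarrow> nat \<Rightarrow> ('m \<Rightarrow> real) \<Rightarrow> bool" where
  "test_function E m A r g \<longleftrightarrow>
     (if E then integrable m g else (\<lambda>x. complex_of_real (g x)) \<in> Cr_manifold A r)"

definition test_norm ::
    "bool \<Rightarrow> 'm measure \<Rightarrow> (('m::topological_space, 'k::finite) chart \<times> 'm set) set \<Rightarrow> nat \<Rightarrow> ('m \<Rightarrow> real) \<Rightarrow> real" where
  "test_norm E m N r g = (if E then \<integral>x. \<bar>g x\<bar> \<partial>m else Cr_norm N r (\<lambda>x. complex_of_real (g x)))"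

lemma bounded_function_space_integrable:
  fixes fn :: "'w::real_normed_vector \<Rightarrow> 'm::topological_space \<Rightarrow> complex"
  assumes fn: "bounded_function_space fn" and m: "sets m = sets borel" and g: "integrable m g"
  shows "integrable m (\<lambda>x. complex_of_real (g x) * fn w x)"
proof (rule Bochner_Integration.integrable_bound)
  show "integrable m (\<lambda>x. norm w * g x)" using g by simp
  have "fn w \<in> borel_measurable m"
    using fn by (simp add: bounded_function_space_def measurable_cong_sets[OF m])
  then show "(\<lambda>x. complex_of_real (g x) * fn w x) \<in> borel_measurable m"
    using g by measurable
  have "norm (fn w x) * \<bar>g x\<bar> \<le> norm w * \<bar>g x\<bar>" for x
    using fn by (intro mult_right_mono) (auto simp: bounded_function_space_def)
  then show "AE x in m. norm (complex_of_real (g x) * fn w x) \<le> norm (norm w * g x)"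
    by (simp add: norm_mult abs_mult mult.commute)
qed

lemma pairing_linear:
  fixes fn :: "'w::real_normed_vector \<Rightarrow> 'm::topological_space \<Rightarrow> complex"
  assumes space: "if E then bounded_function_space fn else distribution_space A N r D"
    and m: "sets m = sets borel" and g: "test_function E m A r g"
  shows "linear (\<lambda>w. pairing E m fn D w (\<lambda>x. complex_of_real (g x)))"
proof (cases E)
  case True
  then have fn: "bounded_function_space fn" and g: "integrable m g"
    using space g by (auto simp: test_function_def)
  note int = bounded_function_space_integrable[OF fn m g]
  have lin: "linear (\<lambda>w. fn w x)" for x using fn by (simp add: bounded_function_space_def)
  show ?thesis
  proof
    fix v w :: 'w and c :: real
    show "pairing E m fn D (v + w) (\<lambda>x. complex_of_real (g x))
        = pairing E m fn D v (\<lambda>x. complex_of_real (g x)) + pairing E m fn D w (\<lambda>x. complex_of_real (g x))"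
      using True int by (simp add: pairing_def linear_add[OF lin] distrib_left)
    have "(\<integral>x. complex_of_real (g x) * (c *\<^sub>R fn w x) \<partial>m) = (\<integral>x. c *\<^sub>R (complex_of_real (g x) * fn w x) \<partial>m)"
      by simp
    also have "\<dots> = c *\<^sub>R (\<integral>x. complex_of_real (g x) * fn w x \<partial>m)"
      by (rule integral_scaleR_right)
    finally show "pairing E m fn D (c *\<^sub>R w) (\<lambda>x. complex_of_real (g x))
        = c *\<^sub>R pairing E m fn D w (\<lambda>x. complex_of_real (g x))"
      using True by (simp add: pairing_def linear_scale[OF lin])
  qed
next
  case False
  then show ?thesis using space g by (simp add: pairing_def distribution_space_def test_function_def)
qed

text \<open>The constant is 1 in case (E), where the weak norm dominates the supremum norm, and the
  continuity constant of the distributions in case (H).\<close>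

lemma pairing_bound:
  fixes fn :: "'w::real_normed_vector \<Rightarrow> 'm::topological_space \<Rightarrow> complex"
  assumes space: "if E then bounded_function_space fn else distribution_space A N r D"
    and m: "sets m = sets borel"
  obtains c where "c \<ge> 0" "\<And>w g. test_function E m A r g \<Longrightarrow>
    norm (pairing E m fn D w (\<lambda>x. complex_of_real (g x))) \<le> c * norm w * test_norm E m N r g"
proof (cases E)
  case True
  then have fn: "bounded_function_space fn" using space by simp
  show thesis
  proof (rule that[of 1])
    fix w :: 'w and g assume "test_function E m A r g"
    with True have g: "integrable m g" by (simp add: test_function_def)
    have "norm (\<integral>x. complex_of_real (g x) * fn w x \<partial>m) \<le> (\<integral>x. norm w * \<bar>g x\<bar> \<partial>m)"
    proof (rule order_trans[OF Bochner_Integration.integral_norm_bound integral_mono])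
      have "norm (fn w x) * \<bar>g x\<bar> \<le> norm w * \<bar>g x\<bar>" for x
        using fn by (intro mult_right_mono) (auto simp: bounded_function_space_def)
      then show "norm (complex_of_real (g x) * fn w x) \<le> norm w * \<bar>g x\<bar>" for x
        by (simp add: norm_mult mult.commute)
    qed (use g bounded_function_space_integrable[OF fn m g] in auto)
    then show "norm (pairing E m fn D w (\<lambda>x. complex_of_real (g x))) \<le> 1 * norm w * test_norm E m N r g"
      using True by (simp add: pairing_def test_norm_def)
  qed simp
next
  case False
  with space obtain c where "c > 0" "\<And>h f. f \<in> Cr_manifold A r \<Longrightarrow> norm (D h f) \<le> c * norm h * Cr_norm N r f"
    by (auto simp: distribution_space_def)
  then show thesis using False
    by (intro that[of c]) (auto simp: pairing_def test_norm_def test_function_def)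
qed

text \<open>Connects the measure used in building \<mu> with the Banach space element. In case (E)
  the function is almost everywhere real and nonnegative, so passing to \<open>Re\<close> and
  \<open>ennreal\<close> loses nothing.\<close>

lemma kernel_eq_pairing:
  fixes fn :: "'w::real_normed_vector \<Rightarrow> 'm::topological_space \<Rightarrow> complex"
  assumes fn: "E \<Longrightarrow> bounded_function_space fn" and m: "sets m = sets borel"
    and k: "if E then (AE x in m. fn w x \<in> \<real>\<^sub>\<ge>\<^sub>0) \<and> k = density m (\<lambda>x. ennreal (Re (fn w x)))
        else \<forall>f\<in>Cr_manifold A r. D w f = (\<integral>x. f x \<partial>k)"
    and g: "test_function E m A r g"
  shows "complex_of_real (\<integral>x. g x \<partial>k) = pairing E m fn D w (\<lambda>x. complex_of_real (g x))"
proof (cases E)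
  case True
  then have pos: "AE x in m. fn w x \<in> \<real>\<^sub>\<ge>\<^sub>0" and k: "k = density m (\<lambda>x. ennreal (Re (fn w x)))"
    and g: "integrable m g"
    using k g by (auto simp: test_function_def)
  have [measurable]: "fn w \<in> borel_measurable m"
    using fn[OF True] by (simp add: bounded_function_space_def measurable_cong_sets[OF m])
  have [measurable]: "g \<in> borel_measurable m" using g by simp
  have "(\<integral>x. g x \<partial>k) = (\<integral>x. Re (fn w x) * g x \<partial>m)"
    unfolding k using pos
    by (subst integral_density) (auto simp: nonneg_Reals_def elim!: eventually_mono)
  then have "complex_of_real (\<integral>x. g x \<partial>k) = (\<integral>x. complex_of_real (Re (fn w x) * g x) \<partial>m)"
    by (simp only: integral_complex_of_real)
  also have "\<dots> = (\<integral>x. complex_of_real (g x) * fn w x \<partial>m)"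
    using pos by (intro integral_cong_AE) (auto simp: nonneg_Reals_def elim!: eventually_mono)
  finally show ?thesis using True by (simp add: pairing_def)
next
  case False
  then show ?thesis using k g by (simp add: pairing_def test_function_def)
qed

text \<open>In case (E) the density is at most \<open>C\<close>, in case (H) a probability measure
  integrates a function bounded by its norm; \<open>max 1 C\<close> covers both.\<close>

lemma kernel_nn_integral_bound:
  fixes fn :: "'w::real_normed_vector \<Rightarrow> 'm::topological_space \<Rightarrow> complex"
  assumes space: "if E then bounded_function_space fn else smooth_atlas A \<and> chart_cover A N"
    and m: "sets m = sets borel" and "prob_space k"
    and k: "E \<Longrightarrow> k = density m (\<lambda>x. ennreal (Re (fn w x)))"
    and w: "norm w \<le> C"
    and g: "test_function E m A r g"
  shows "(\<integral>\<^sup>+x. ennreal \<bar>g x\<bar> \<partial>k) \<le> ennreal (max 1 C * test_norm E m N r g)"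
proof (cases E)
  case True
  then have fn: "bounded_function_space fn" and k: "k = density m (\<lambda>x. ennreal (Re (fn w x)))"
    and g: "integrable m g"
    using space k g by (auto simp: test_function_def)
  have [measurable]: "fn w \<in> borel_measurable m"
    using fn by (simp add: bounded_function_space_def measurable_cong_sets[OF m])
  have [measurable]: "g \<in> borel_measurable m" using g by simp
  have "(\<integral>\<^sup>+x. ennreal \<bar>g x\<bar> \<partial>k) = (\<integral>\<^sup>+x. ennreal (Re (fn w x)) * ennreal \<bar>g x\<bar> \<partial>m)"
    unfolding k by (rule nn_integral_density) auto
  also have "\<dots> \<le> (\<integral>\<^sup>+x. ennreal (max 1 C) * ennreal \<bar>g x\<bar> \<partial>m)"
  proof (intro nn_integral_mono mult_right_mono ennreal_leI)
    fix x
    have "norm (fn w x) \<le> norm w" using fn by (simp add: bounded_function_space_def)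
    then show "Re (fn w x) \<le> max 1 C" using w complex_Re_le_cmod[of "fn w x"] by linarith
  qed simp
  also have "\<dots> = ennreal (max 1 C) * ennreal (\<integral>x. \<bar>g x\<bar> \<partial>m)"
    using g by (simp add: nn_integral_cmult nn_integral_eq_integral)
  also have "\<dots> = ennreal (max 1 C * test_norm E m N r g)"
    using True by (simp add: test_norm_def ennreal_mult)
  finally show ?thesis .
next
  case False
  interpret prob_space k by fact
  let ?n = "test_norm E m N r g"
  have "norm (complex_of_real (g x)) \<le> ?n" for x
    unfolding test_norm_def using False space g
    by (auto simp: test_function_def simp del: norm_of_real intro!: norm_le_Cr_norm)
  then have gn: "\<bar>g x\<bar> \<le> ?n" for x by simp
  then have "?n \<le> max 1 C * ?n"
    using order_trans[OF abs_ge_zero gn] by (simp add: mult_right_mono[of 1 "max 1 C", simplified])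
  then have "\<bar>g x\<bar> \<le> max 1 C * ?n" for x using gn[of x] by linarith
  then have "(\<integral>\<^sup>+x. ennreal \<bar>g x\<bar> \<partial>k) \<le> (\<integral>\<^sup>+x. ennreal (max 1 C * ?n) \<partial>k)"
    by (intro nn_integral_mono ennreal_leI)
  then show ?thesis by (simp add: emeasure_space_1)
qed

section \<open>Annealed linear response\<close>

theorem theorem4:
  fixes A\<Omega> :: "('o::metric_space, 'n::finite) chart set"
    and G\<Omega> :: "('o, 'n) chart \<Rightarrow> 'o \<Rightarrow> real^'n^'n"
    and AM :: "('m::t2_space, 'k::finite) chart set"
    and GM :: "('m, 'k) chart \<Rightarrow> 'm \<Rightarrow> real^'k^'k"
    and m :: "'m measure"
    and I :: "real set"
    and \<sigma> :: "real \<Rightarrow> 'o \<Rightarrow> 'o"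
    and P :: "real \<Rightarrow> 'o measure"
    and i\<^sub>s :: "'s::banach \<Rightarrow> 'w::banach"
    and i\<^sub>s\<^sub>s :: "'ss::banach \<Rightarrow> 's"
    and \<psi> :: "'w \<Rightarrow>\<^sub>L complex"
    and Lw :: "'o \<Rightarrow> real \<Rightarrow> 'w \<Rightarrow>\<^sub>L 'w"
    and Ls :: "'o \<Rightarrow> real \<Rightarrow> 's \<Rightarrow>\<^sub>L 's"
    and E :: bool
    and fn :: "'w \<Rightarrow> 'm \<Rightarrow> complex"
    and D :: "'w \<Rightarrow> ('m \<Rightarrow> complex) \<Rightarrow> complex"
    and r :: nat
    and N :: "(('m, 'k) chart \<times> 'm set) set"
    and F :: "('o \<Rightarrow> real) set"
    and nF :: "('o \<Rightarrow> real) \<Rightarrow> real"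
    and C \<alpha> \<zeta> K c :: real
    and \<Omega>\<^sub>e :: "real \<Rightarrow> 'o set"
    and \<Omega>' :: "'o set"
    and h :: "real \<Rightarrow> 'o \<Rightarrow> 's"
    and h\<^sub>s\<^sub>s :: "'o \<Rightarrow> 'ss"
    and \<Lambda> :: "'o \<Rightarrow> nat \<Rightarrow> 'ss \<Rightarrow>\<^sub>L 's"
    and \<kappa> :: "real \<Rightarrow> 'o \<Rightarrow> 'm measure"
    and P' :: "('o \<Rightarrow> real) \<Rightarrow> real"
    and \<Gamma> :: "'o \<Rightarrow> 'w"
    and \<Phi> :: "'o \<times> 'm \<Rightarrow> real"
    and \<phi>\<^sub>h \<phi>\<^sub>\<Gamma> :: "'o \<Rightarrow> real"
    and \<mu> :: "real \<Rightarrow> ('o \<times> 'm) measure"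
  assumes \<Omega>_manifold: "compact_riemannian_manifold A\<Omega> G\<Omega>" "dist_is_riemannian A\<Omega> G\<Omega>"
    and M_manifold: "compact_riemannian_manifold AM GM" "normalized_volume AM GM m"
    and I: "0 \<in> I" "0 islimpt I"
    and \<sigma>_homeo: "\<And>\<epsilon>. \<epsilon> \<in> I \<Longrightarrow> homeomorphism UNIV UNIV (\<sigma> \<epsilon>) (inv (\<sigma> \<epsilon>))"
    and \<sigma>_cont: "continuous_on (UNIV \<times> I) (\<lambda>(\<omega>, \<epsilon>). \<sigma> \<epsilon> \<omega>)"
    and P: "\<And>\<epsilon>. \<epsilon> \<in> I \<Longrightarrow> prob_space (P \<epsilon>)" "\<And>\<epsilon>. \<epsilon> \<in> I \<Longrightarrow> sets (P \<epsilon>) = sets borel"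
    and P_invariant: "\<And>\<epsilon>. \<epsilon> \<in> I \<Longrightarrow> distr (P \<epsilon>) (P \<epsilon>) (\<sigma> \<epsilon>) = P \<epsilon>"
    and embed_s: "bounded_linear i\<^sub>s" "inj i\<^sub>s" "\<And>g. norm (i\<^sub>s g) \<le> norm g"
    and embed_ss: "bounded_linear i\<^sub>s\<^sub>s" "inj i\<^sub>s\<^sub>s" "\<And>g. norm (i\<^sub>s\<^sub>s g) \<le> norm g"
    and \<psi>_nonzero: "\<exists>g. \<psi> (i\<^sub>s g) \<noteq> 0"
    and L_compat: "\<And>\<omega> \<epsilon> g. \<epsilon> \<in> I \<Longrightarrow> i\<^sub>s (Ls \<omega> \<epsilon> g) = Lw \<omega> \<epsilon> (i\<^sub>s g)"
    and L_\<psi>: "\<And>\<omega> \<epsilon> g. \<epsilon> \<in> I \<Longrightarrow> \<psi> (Lw \<omega> \<epsilon> g) = \<psi> g"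
    and space: "if E then bounded_function_space fn
                else chart_cover AM N \<and> distribution_space AM N r D"
    and F: "seminormed_function_space F nF"
    and F_bound: "bdd_above {\<bar>\<integral>\<omega>. f \<omega> \<partial>P \<epsilon>\<bar> | \<epsilon> f. \<epsilon> \<in> I \<and> f \<in> F \<and> nF f \<le> 1}"
    and constants: "C > 0" "\<alpha> > 0" "0 < \<zeta>" "\<zeta> \<le> 1"
    and \<Omega>\<^sub>e: "\<And>\<epsilon>. \<epsilon> \<in> I \<Longrightarrow> \<Omega>\<^sub>e \<epsilon> \<in> sets borel" "\<And>\<epsilon>. \<epsilon> \<in> I \<Longrightarrow> \<sigma> \<epsilon> -` \<Omega>\<^sub>e \<epsilon> = \<Omega>\<^sub>e \<epsilon>"
      "\<And>\<epsilon>. \<epsilon> \<in> I \<Longrightarrow> measure (P \<epsilon>) (\<Omega>\<^sub>e \<epsilon>) = 1"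
    and A1: "\<And>n \<epsilon> \<omega> g. \<epsilon> \<in> I \<Longrightarrow> \<omega> \<in> \<Omega>\<^sub>e \<epsilon> \<Longrightarrow> \<psi> g = 0 \<Longrightarrow>
        norm (cocycle (\<sigma> \<epsilon>) (\<lambda>\<omega>. Lw \<omega> \<epsilon>) n \<omega> g) \<le> C * exp (- \<alpha> * real n) * norm g"
    and A2: "\<And>\<epsilon> \<omega> \<omega>' g. \<epsilon> \<in> I \<Longrightarrow> \<omega> \<in> \<Omega>\<^sub>e \<epsilon> \<Longrightarrow> \<omega>' \<in> \<Omega>\<^sub>e 0 \<Longrightarrow>
        norm (Lw \<omega> \<epsilon> (i\<^sub>s g) - Lw \<omega>' 0 (i\<^sub>s g)) \<le> C * (dist \<omega> \<omega>' powr \<zeta> + \<bar>\<epsilon>\<bar> powr \<zeta>) * norm g"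
    and A3: "\<And>\<epsilon> \<omega>. \<epsilon> \<in> I \<Longrightarrow> \<omega> \<in> \<Omega>\<^sub>e \<epsilon> \<Longrightarrow> \<psi> (i\<^sub>s (h \<epsilon> \<omega>)) = 1 \<and> norm (h \<epsilon> \<omega>) \<le> C"
    and A4: "\<And>\<epsilon> \<omega>. \<epsilon> \<in> I \<Longrightarrow> \<omega> \<in> \<Omega>\<^sub>e \<epsilon> \<Longrightarrow> Ls \<omega> \<epsilon> (h \<epsilon> \<omega>) = h \<epsilon> (\<sigma> \<epsilon> \<omega>)"
    and A5: "\<exists>B. B-lipschitz_on UNIV (inv (\<sigma> 0))"
    and B1: "K > 0" "\<And>\<omega> j. \<omega> \<in> \<Omega>\<^sub>e 0 \<Longrightarrow> norm (cocycle (\<sigma> 0) (\<lambda>\<omega>. Ls \<omega> 0) j \<omega>) \<le> K"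
    and B2: "\<And>\<omega>. \<omega> \<in> \<Omega>\<^sub>e 0 \<Longrightarrow> i\<^sub>s\<^sub>s (h\<^sub>s\<^sub>s \<omega>) = h 0 \<omega> \<and> norm (h\<^sub>s\<^sub>s \<omega>) \<le> C"
    and B3: "\<And>\<gamma>. curve_differentiable_at A\<Omega> I \<gamma> 0 \<Longrightarrow>
        \<exists>T. operator_derivative I C \<zeta> i\<^sub>s\<^sub>s (\<lambda>g. \<psi> (i\<^sub>s g)) Ls \<gamma> T"
    and B4: "\<And>k \<omega>. curve_differentiable_at A\<Omega> I (\<lambda>\<epsilon>. (inv (\<sigma> \<epsilon>) ^^ k) \<omega>) 0"
      "\<And>k. (C * exp (c * real k))-lipschitz_on UNIV (inv (\<sigma> 0) ^^ k)" "c < \<alpha> / (1 + \<zeta>)"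
    and B5: "(\<lambda>\<epsilon>. dist_C0 (inv (\<sigma> 0)) (inv (\<sigma> \<epsilon>))) \<in> O[at 0 within I](\<lambda>\<epsilon>. \<epsilon>)"
    and \<Lambda>: "\<And>\<omega> j. operator_derivative I C \<zeta> i\<^sub>s\<^sub>s (\<lambda>g. \<psi> (i\<^sub>s g)) Ls
        (\<lambda>\<epsilon>. (inv (\<sigma> \<epsilon>) ^^ Suc j) \<omega>) (\<Lambda> \<omega> j)"
    and B6: "bdd_above (range (\<lambda>(\<omega>, j). norm (\<Lambda> \<omega> j)))"
    and C1: "\<Omega>' \<in> sets borel" "\<And>\<epsilon>. \<epsilon> \<in> I \<Longrightarrow> \<Omega>' \<subseteq> \<Omega>\<^sub>e \<epsilon> \<and> measure (P \<epsilon>) \<Omega>' = 1"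
    and C2: "\<And>\<epsilon>. \<epsilon> \<in> I \<Longrightarrow> \<kappa> \<epsilon> \<in> restrict_space borel (\<Omega>\<^sub>e \<epsilon>) \<rightarrow>\<^sub>M prob_algebra borel"
      "\<And>\<epsilon> \<omega>. \<epsilon> \<in> I \<Longrightarrow> \<omega> \<in> \<Omega>\<^sub>e \<epsilon> \<Longrightarrow>
        if E then (AE x in m. fn (i\<^sub>s (h \<epsilon> \<omega>)) x \<in> \<real>\<^sub>\<ge>\<^sub>0) \<and>
                  \<kappa> \<epsilon> \<omega> = density m (\<lambda>x. ennreal (Re (fn (i\<^sub>s (h \<epsilon> \<omega>)) x)))
        else \<forall>f\<in>Cr_manifold AM r. D (i\<^sub>s (h \<epsilon> \<omega>)) f = (\<integral>x. f x \<partial>\<kappa> \<epsilon> \<omega>)"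
    and C3: "((\<lambda>\<epsilon>. dual_seminorm_diff F nF (P \<epsilon>) (P 0)) \<longlongrightarrow> 0) (at 0 within I)"
    and P': "\<And>f. f \<in> F \<Longrightarrow> ((\<lambda>\<epsilon>. \<integral>\<omega>. f \<omega> \<partial>P \<epsilon>) has_real_derivative P' f) (at 0 within I)"
    and \<Gamma>: "\<And>\<omega>. \<omega> \<in> \<Omega>\<^sub>e 0 \<Longrightarrow> \<Gamma> \<omega> =
        (\<Sum>j. i\<^sub>s (cocycle (\<sigma> 0) (\<lambda>\<omega>. Ls \<omega> 0) j ((inv (\<sigma> 0) ^^ j) \<omega>)
                    (\<Lambda> \<omega> j (h\<^sub>s\<^sub>s ((inv (\<sigma> 0) ^^ Suc j) \<omega>)))))"
    and \<Phi>_measurable: "\<Phi> \<in> borel_measurable (borel \<Otimes>\<^sub>M borel)"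
    and \<Phi>_fiber: "\<And>\<omega>. if E then integrable m (\<lambda>x. \<Phi> (\<omega>, x))
        else (\<lambda>x. complex_of_real (\<Phi> (\<omega>, x))) \<in> Cr_manifold AM r"
    and \<phi>\<^sub>h: "\<phi>\<^sub>h \<in> F" "\<And>\<omega>. \<omega> \<in> \<Omega>\<^sub>e 0 \<Longrightarrow> complex_of_real (\<phi>\<^sub>h \<omega>) =
        pairing E m fn D (i\<^sub>s (h 0 \<omega>)) (\<lambda>x. complex_of_real (\<Phi> (\<omega>, x)))"
    and \<phi>\<^sub>\<Gamma>: "\<phi>\<^sub>\<Gamma> \<in> F" "\<And>\<omega>. \<omega> \<in> \<Omega>\<^sub>e 0 \<Longrightarrow> complex_of_real (\<phi>\<^sub>\<Gamma> \<omega>) =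
        pairing E m fn D (\<Gamma> \<omega>) (\<lambda>x. complex_of_real (\<Phi> (\<omega>, x)))"
    and \<theta>: "(\<lambda>\<omega>. if E then \<integral>x. \<bar>\<Phi> (\<omega>, x)\<bar> \<partial>m
                 else Cr_norm N r (\<lambda>x. complex_of_real (\<Phi> (\<omega>, x)))) \<in> F"
    and \<mu>: "\<And>\<epsilon>. \<epsilon> \<in> I \<Longrightarrow> sets (\<mu> \<epsilon>) = sets (borel \<Otimes>\<^sub>M borel)"
      "\<And>\<epsilon> S B. \<epsilon> \<in> I \<Longrightarrow> S \<in> sets borel \<Longrightarrow> B \<in> sets borel \<Longrightarrow>
        emeasure (\<mu> \<epsilon>) (S \<times> B) = (\<integral>\<^sup>+\<omega>\<in>S \<inter> \<Omega>\<^sub>e \<epsilon>. emeasure (\<kappa> \<epsilon> \<omega>) B \<partial>P \<epsilon>)"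
  shows "(\<forall>\<omega>\<in>\<Omega>\<^sub>e 0. summable (\<lambda>j.
            i\<^sub>s (cocycle (\<sigma> 0) (\<lambda>\<omega>. Ls \<omega> 0) j ((inv (\<sigma> 0) ^^ j) \<omega>)
                  (\<Lambda> \<omega> j (h\<^sub>s\<^sub>s ((inv (\<sigma> 0) ^^ Suc j) \<omega>)))))) \<and>
         ((\<lambda>\<epsilon>. ((\<integral>z. \<Phi> z \<partial>\<mu> \<epsilon>) - (\<integral>z. \<Phi> z \<partial>\<mu> 0)) / \<epsilon>)
            \<longlongrightarrow> (\<integral>\<omega>. \<phi>\<^sub>\<Gamma> \<omega> \<partial>P 0) + P' \<phi>\<^sub>h) (at 0 within I)"
proof -

  \<comment> \<open>The quenched estimate for the given data\<close>
  let ?\<Gamma>s = "\<lambda>\<omega> j. i\<^sub>s (cocycle (\<sigma> 0) (\<lambda>\<omega>. Ls \<omega> 0) j ((inv (\<sigma> 0) ^^ j) \<omega>)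
                    (\<Lambda> \<omega> j (h\<^sub>s\<^sub>s ((inv (\<sigma> 0) ^^ Suc j) \<omega>))))"
  have bij: "bij (\<sigma> \<epsilon>)" if "\<epsilon> \<in> I" for \<epsilon>
    using \<sigma>_homeo[OF that] by (auto simp: homeomorphism_def intro!: o_bij[of "inv (\<sigma> \<epsilon>)"])
  have "bounded (UNIV :: 'o set)"
    using \<Omega>_manifold(1) by (simp add: compact_riemannian_manifold_def compact_imp_bounded)
  then have dist_le: "dist x y \<le> diameter (UNIV :: 'o set)" for x y :: 'o
    by (rule diameter_bounded_bound) auto
  obtain V where "V > 0" and V: "\<forall>\<^sub>F \<epsilon> in at 0 within I.
      norm (dist_C0 (inv (\<sigma> 0)) (inv (\<sigma> \<epsilon>))) \<le> V * norm \<epsilon>"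
    using landau_o.bigE[OF B5] by blast
  have V: "\<forall>\<^sub>F \<epsilon> in at 0 within I. \<forall>y. dist (inv (\<sigma> \<epsilon>) y) (inv (\<sigma> 0) y) \<le> V * \<bar>\<epsilon>\<bar>"
    using V
  proof eventually_elim
    case (elim \<epsilon>)
    \<comment> \<open>Compactness bounds all distances, so the real supremum in
      \<open>dist_C0\<close> dominates each of its members.\<close>
    have dist_le_C0: "dist (inv (\<sigma> \<epsilon>) y) (inv (\<sigma> 0) y) \<le> dist_C0 (inv (\<sigma> 0)) (inv (\<sigma> \<epsilon>))" for y
      unfolding dist_C0_def dist_commute[of "inv (\<sigma> \<epsilon>) y"] by (rule cSUP_upper[OF UNIV_I bdd_aboveI2[OF dist_le]])
    show ?case
    proof
      show "dist (inv (\<sigma> \<epsilon>) y) (inv (\<sigma> 0) y) \<le> V * \<bar>\<epsilon>\<bar>" for y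
        using dist_le_C0[of y] elim by simp
    qed
  qed
  obtain Q where Q: "norm (\<Lambda> \<omega> j) \<le> Q" for \<omega> j
  proof -
    obtain q where "\<forall>x\<in>range (\<lambda>(\<omega>, j). norm (\<Lambda> \<omega> j)). x \<le> q" using B6 unfolding bdd_above_def ..
    then have "norm (\<Lambda> \<omega> j) \<le> q" for \<omega> j by (rule bspec) (auto intro: rev_image_eqI[of "(\<omega>, j)"])
    then show thesis by (rule that)
  qed
  obtain B where "B \<ge> 0" and B: "\<forall>\<epsilon>\<in>I.
      (\<forall>y. dist (inv (\<sigma> \<epsilon>) y) (inv (\<sigma> 0) y) \<le> V * \<bar>\<epsilon>\<bar>) \<longrightarrow> (\<forall>\<omega>\<in>\<Omega>\<^sub>e \<epsilon> \<inter> \<Omega>\<^sub>e 0.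
      summable (?\<Gamma>s \<omega>) \<and> norm (i\<^sub>s (h \<epsilon> \<omega>) - i\<^sub>s (h 0 \<omega>) - \<epsilon> *\<^sub>R (\<Sum>j. ?\<Gamma>s \<omega> j))
        \<le> B * (\<bar>\<epsilon>\<bar> * (\<bar>\<epsilon>\<bar> powr \<zeta> + sqrt (\<bar>\<epsilon>\<bar> powr \<zeta>))))"
    by (rule quenched_linear_response[OF I(1) bij embed_s(1,3) L_compat L_\<psi> constants(1-3) \<Omega>\<^sub>e(2)
        A1 A2 A3 A4 B1(2) B2 B4(2,3) \<Lambda> Q less_imp_le[OF \<open>V > 0\<close>]])
  \<comment> \<open>At \<epsilon> = 0 the closeness premise holds trivially, which gives summability
    on all of \<open>\<Omega>\<^sub>e 0\<close>.\<close>
  have summable: "\<forall>\<omega>\<in>\<Omega>\<^sub>e 0. summable (?\<Gamma>s \<omega>)"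
    using bspec[OF B I(1)] by simp

  \<comment> \<open>Pairing with the fibres of \<Phi>, bounded uniformly in \<omega>\<close>
  have m: "sets m = sets borel"
    using M_manifold(2) by (auto simp: normalized_volume_def riemannian_volume_def)
  have atlas: "smooth_atlas AM"
    using M_manifold(1) by (simp add: compact_riemannian_manifold_def)
  have space': "if E then bounded_function_space fn else distribution_space AM N r D"
    "if E then bounded_function_space fn else smooth_atlas AM \<and> chart_cover AM N"
    "E \<Longrightarrow> bounded_function_space fn"
    using space atlas by (auto split: if_splits)
  have test: "test_function E m AM r (\<lambda>x. \<Phi> (\<omega>, x))" for \<omega>
    using \<Phi>_fiber[of \<omega>] by (simp add: test_function_def)
  let ?\<theta> = "\<lambda>\<omega>. test_norm E m N r (\<lambda>x. \<Phi> (\<omega>, x))"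
  have "?\<theta> \<in> F" using \<theta> by (simp add: test_norm_def)
  \<comment> \<open>Members of \<open>F\<close> are bounded functions; this makes the pairing
    estimate uniform in \<omega>.\<close>
  then obtain \<Theta> where \<Theta>: "\<bar>?\<theta> \<omega>\<bar> \<le> \<Theta>" for \<omega>
    using F unfolding seminormed_function_space_def bounded_iff by fastforce
  have "0 \<le> \<Theta>" using \<Theta>[of undefined] by linarith
  let ?pair = "\<lambda>w \<omega>. pairing E m fn D w (\<lambda>x. complex_of_real (\<Phi> (\<omega>, x)))"
  obtain b where "b \<ge> 0" and b: "\<And>w g. test_function E m AM r g \<Longrightarrow>
      norm (pairing E m fn D w (\<lambda>x. complex_of_real (g x))) \<le> b * norm w * test_norm E m N r g"
    using pairing_bound[OF space'(1) m] by blast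
  have pair_bound: "norm (?pair w \<omega>) \<le> b * norm w * \<Theta>" for w \<omega>
    using b[OF test, of w \<omega>] abs_ge_self[of "?\<theta> \<omega>"] \<Theta>[of \<omega>] \<open>b \<ge> 0\<close>
    by (meson mult_left_mono mult_nonneg_nonneg norm_ge_zero order_trans)
  have pair_linear: "linear (\<lambda>w. ?pair w \<omega>)" for \<omega>
    by (rule pairing_linear[OF space'(1) m test[of \<omega>]])

  \<comment> \<open>Integrals against \<open>\<mu> \<epsilon>\<close> as integrals over the
    base\<close>
  define \<kappa>' where "\<kappa>' \<epsilon> \<omega> = (if \<omega> \<in> \<Omega>\<^sub>e \<epsilon> then \<kappa> \<epsilon> \<omega> else return borel undefined)" for \<epsilon> \<omega>
  define g where "g \<epsilon> \<omega> = (\<integral>x. \<Phi> (\<omega>, x) \<partial>\<kappa>' \<epsilon> \<omega>)" for \<epsilon> \<omega>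
  have AE_\<Omega>': "AE \<omega> in P \<epsilon>. \<omega> \<in> \<Omega>'" if "\<epsilon> \<in> I" for \<epsilon>
    using prob_space.prob_eq_1[OF P(1)[OF that], of \<Omega>'] C1 P(2) that by auto
  have AE_\<Omega>: "AE \<omega> in P \<epsilon>. \<omega> \<in> \<Omega>\<^sub>e \<epsilon>" if "\<epsilon> \<in> I" for \<epsilon>
    using AE_\<Omega>'[OF that] C1(2)[OF that] by auto
  \<comment> \<open>(C2) gives measurability on \<open>\<Omega>\<^sub>e \<epsilon>\<close> only. The
    Dirac measure as default value makes \<kappa>' a probability kernel on the whole base, at the
    price of a change on a null set.\<close>
  have \<kappa>'_meas: "\<kappa>' \<epsilon> \<in> P \<epsilon> \<rightarrow>\<^sub>M prob_algebra borel" if "\<epsilon> \<in> I" for \<epsilon>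
  proof -
    have "\<kappa>' \<epsilon> \<in> borel \<rightarrow>\<^sub>M prob_algebra borel"
      unfolding \<kappa>'_def using C2(1)[OF that] \<Omega>\<^sub>e(1)[OF that]
      by (subst measurable_If_restrict_space_iff)
        (auto intro!: measurable_const simp: space_prob_algebra prob_space_return)
    then show ?thesis by (simp add: measurable_cong_sets[OF P(2)[OF that] refl])
  qed
  have g_pair: "complex_of_real (g \<epsilon> \<omega>) = ?pair (i\<^sub>s (h \<epsilon> \<omega>)) \<omega>" if "\<epsilon> \<in> I" "\<omega> \<in> \<Omega>\<^sub>e \<epsilon>" for \<epsilon> \<omega>
    using kernel_eq_pairing[where fn = fn and D = D and w = "i\<^sub>s (h \<epsilon> \<omega>)", OF space'(3) m C2(2)[OF that] test[of \<omega>]] that by (simp add: g_def \<kappa>'_def)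
  have fiber_bound: "AE \<omega> in P \<epsilon>. (\<integral>\<^sup>+x. ennreal \<bar>\<Phi> (\<omega>, x)\<bar> \<partial>\<kappa>' \<epsilon> \<omega>) \<le> ennreal (max 1 C * \<Theta>)"
    if \<epsilon>: "\<epsilon> \<in> I" for \<epsilon>
    using AE_\<Omega>[OF \<epsilon>] AE_space
  proof eventually_elim
    case (elim \<omega>)
    have prob: "prob_space (\<kappa>' \<epsilon> \<omega>)"
      using measurable_space[OF \<kappa>'_meas[OF \<epsilon>] elim(2)] by (simp add: space_prob_algebra)
    have density: "\<kappa>' \<epsilon> \<omega> = density m (\<lambda>x. ennreal (Re (fn (i\<^sub>s (h \<epsilon> \<omega>)) x)))" if E
      using C2(2)[OF \<epsilon> elim(1)] that elim(1) by (simp add: \<kappa>'_def)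
    have norm: "norm (i\<^sub>s (h \<epsilon> \<omega>)) \<le> C"
      using A3[OF \<epsilon> elim(1)] embed_s(3)[of "h \<epsilon> \<omega>"] by linarith
    have "(\<integral>\<^sup>+x. ennreal \<bar>\<Phi> (\<omega>, x)\<bar> \<partial>\<kappa>' \<epsilon> \<omega>) \<le> ennreal (max 1 C * ?\<theta> \<omega>)"
      by (rule kernel_nn_integral_bound[where fn = fn, OF space'(2) m prob density norm test])
    also have "\<dots> \<le> ennreal (max 1 C * \<Theta>)"
      using \<Theta>[of \<omega>] by (intro ennreal_leI mult_left_mono) auto
    finally show ?case .
  qed
  have int_\<mu>: "integrable (P \<epsilon>) (g \<epsilon>)" "(\<integral>z. \<Phi> z \<partial>\<mu> \<epsilon>) = (\<integral>\<omega>. g \<epsilon> \<omega> \<partial>P \<epsilon>)" if \<epsilon>: "\<epsilon> \<in> I" for \<epsilon>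
  proof -
    have sets: "sets (P \<epsilon> \<Otimes>\<^sub>M borel) = sets (borel \<Otimes>\<^sub>M (borel :: 'm measure))"
      by (intro sets_pair_measure_cong P(2) \<epsilon> refl)
    have \<mu>_eq: "emeasure (\<mu> \<epsilon>) (S \<times> A) = (\<integral>\<^sup>+\<omega>\<in>S. emeasure (\<kappa>' \<epsilon> \<omega>) A \<partial>P \<epsilon>)"
      if "S \<in> sets (P \<epsilon>)" "A \<in> sets borel" for S A
    proof -
      have "(\<integral>\<^sup>+\<omega>\<in>S \<inter> \<Omega>\<^sub>e \<epsilon>. emeasure (\<kappa> \<epsilon> \<omega>) A \<partial>P \<epsilon>) = (\<integral>\<^sup>+\<omega>\<in>S. emeasure (\<kappa>' \<epsilon> \<omega>) A \<partial>P \<epsilon>)"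
      proof (rule nn_integral_cong_AE)
        show "AE \<omega> in P \<epsilon>. emeasure (\<kappa> \<epsilon> \<omega>) A * indicator (S \<inter> \<Omega>\<^sub>e \<epsilon>) \<omega>
            = emeasure (\<kappa>' \<epsilon> \<omega>) A * indicator S \<omega>"
          using AE_\<Omega>[OF \<epsilon>] by eventually_elim (simp add: \<kappa>'_def indicator_def)
      qed
      then show ?thesis using \<mu>(2)[OF \<epsilon>, of S A] that P(2)[OF \<epsilon>] by simp
    qed
    have \<Phi>: "\<Phi> \<in> borel_measurable (P \<epsilon> \<Otimes>\<^sub>M borel)"
      using \<Phi>_measurable by (simp add: measurable_cong_sets[OF sets])
    have sets_\<mu>: "sets (\<mu> \<epsilon>) = sets (P \<epsilon> \<Otimes>\<^sub>M borel)" using \<mu>(1)[OF \<epsilon>] sets by simp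
    note disintegration = integral_disintegration[where f = \<Phi>, OF P(1)[OF \<epsilon>] \<kappa>'_meas[OF \<epsilon>] sets_\<mu> \<mu>_eq \<Phi>
        fiber_bound[OF \<epsilon>]]
    have g_eq: "g \<epsilon> = (\<lambda>\<omega>. \<integral>x. \<Phi> (\<omega>, x) \<partial>\<kappa>' \<epsilon> \<omega>)" by (simp add: g_def fun_eq_iff)
    show "integrable (P \<epsilon>) (g \<epsilon>)"
      unfolding g_eq by (rule disintegration(1))
    show "(\<integral>z. \<Phi> z \<partial>\<mu> \<epsilon>) = (\<integral>\<omega>. g \<epsilon> \<omega> \<partial>P \<epsilon>)"
      unfolding g_eq by (rule disintegration(2))
  qed
  have int_F: "integrable (P \<epsilon>) f" if "\<epsilon> \<in> I" "f \<in> F" for \<epsilon> f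
  proof -
    interpret prob_space "P \<epsilon>" by (rule P(1)[OF that(1)])
    have "f \<in> borel_measurable borel" "bounded (range f)"
      using F that(2) by (auto simp: seminormed_function_space_def)
    then have meas: "f \<in> borel_measurable (P \<epsilon>)" and "bounded (range f)"
      by (simp_all add: measurable_cong_sets[OF P(2)[OF that(1)] refl])
    then obtain c where "\<And>x. norm (f x) \<le> c" by (auto simp: bounded_iff)
    with meas show ?thesis by (intro integrable_const_bound[where B = c]) auto
  qed
  have \<phi>\<^sub>h_eq: "\<phi>\<^sub>h \<omega> = g 0 \<omega>" if "\<omega> \<in> \<Omega>\<^sub>e 0" for \<omega>
    using \<phi>\<^sub>h(2)[OF that] g_pair[OF I(1) that] by (simp flip: of_real_eq_iff[where 'a = complex])
  have \<mu>0: "(\<integral>z. \<Phi> z \<partial>\<mu> 0) = (\<integral>\<omega>. \<phi>\<^sub>h \<omega> \<partial>P 0)"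
    unfolding int_\<mu>(2)[OF I(1)]
  proof (rule integral_cong_AE)
    show "AE \<omega> in P 0. g 0 \<omega> = \<phi>\<^sub>h \<omega>"
      using AE_\<Omega>[OF I(1)] by (auto simp: \<phi>\<^sub>h_eq)
  qed (use int_\<mu>(1)[OF I(1)] int_F[OF I(1) \<phi>\<^sub>h(1)] in auto)

  \<comment> \<open>The limit of the difference quotient\<close>
  define \<rho> where "\<rho> \<epsilon> = \<bar>\<epsilon>\<bar> powr \<zeta> + sqrt (\<bar>\<epsilon>\<bar> powr \<zeta>)" for \<epsilon> :: real
  \<comment> \<open>All three terms are integrated against \<open>P \<epsilon>\<close>, so the
    change of the base measure enters only through the integrals of \<open>\<phi>\<^sub>h\<close>
    and \<open>\<phi>\<^sub>\<Gamma>\<close>.\<close>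
  define R where "R \<epsilon> = (\<integral>\<omega>. g \<epsilon> \<omega> - \<phi>\<^sub>h \<omega> - \<epsilon> * \<phi>\<^sub>\<Gamma> \<omega> \<partial>P \<epsilon>)" for \<epsilon>
  have in_I: "\<forall>\<^sub>F \<epsilon> in at 0 within I. \<epsilon> \<in> I \<and> \<epsilon> \<noteq> 0"
    by (simp add: eventually_at_filter)
  have R_bound: "\<forall>\<^sub>F \<epsilon> in at 0 within I. norm (R \<epsilon> / \<epsilon>) \<le> b * B * \<Theta> * \<rho> \<epsilon>"
    using V in_I
  proof eventually_elim
    case (elim \<epsilon>)
    then have \<epsilon>: "\<epsilon> \<in> I" "\<epsilon> \<noteq> 0" by auto
    interpret prob_space "P \<epsilon>" by (rule P(1)[OF \<epsilon>(1)])
    \<comment> \<open>The quenched estimate needs \<omega> in both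
      \<open>\<Omega>\<^sub>e \<epsilon>\<close> and \<open>\<Omega>\<^sub>e 0\<close>. The set
      \<Omega>' lies in both and has full measure for \<open>P \<epsilon>\<close>.\<close>
    have "\<bar>g \<epsilon> \<omega> - \<phi>\<^sub>h \<omega> - \<epsilon> * \<phi>\<^sub>\<Gamma> \<omega>\<bar> \<le> b * (B * (\<bar>\<epsilon>\<bar> * \<rho> \<epsilon>)) * \<Theta>" if "\<omega> \<in> \<Omega>'" for \<omega>
    proof -
      have \<omega>: "\<omega> \<in> \<Omega>\<^sub>e \<epsilon>" "\<omega> \<in> \<Omega>\<^sub>e 0" using that C1(2) \<epsilon>(1) I(1) by auto
      let ?w = "i\<^sub>s (h \<epsilon> \<omega>) - i\<^sub>s (h 0 \<omega>) - \<epsilon> *\<^sub>R \<Gamma> \<omega>"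
      have w: "norm ?w \<le> B * (\<bar>\<epsilon>\<bar> * \<rho> \<epsilon>)"
        using bspec[OF B \<epsilon>(1)] elim(1) \<omega> unfolding \<Gamma>[OF \<omega>(2)] \<rho>_def by blast
      have "complex_of_real (g \<epsilon> \<omega> - \<phi>\<^sub>h \<omega> - \<epsilon> * \<phi>\<^sub>\<Gamma> \<omega>)
          = ?pair (i\<^sub>s (h \<epsilon> \<omega>)) \<omega> - ?pair (i\<^sub>s (h 0 \<omega>)) \<omega> - \<epsilon> *\<^sub>R ?pair (\<Gamma> \<omega>) \<omega>"
        using g_pair[OF \<epsilon>(1) \<omega>(1)] \<phi>\<^sub>h(2)[OF \<omega>(2)] \<phi>\<^sub>\<Gamma>(2)[OF \<omega>(2)] by (simp add: scaleR_conv_of_real)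
      also have "\<dots> = ?pair ?w \<omega>"
        by (simp add: linear_diff[OF pair_linear] linear_scale[OF pair_linear])
      finally have "\<bar>g \<epsilon> \<omega> - \<phi>\<^sub>h \<omega> - \<epsilon> * \<phi>\<^sub>\<Gamma> \<omega>\<bar> = norm (?pair ?w \<omega>)"
        by (metis norm_of_real real_norm_def)
      also have "\<dots> \<le> b * norm ?w * \<Theta>" by (rule pair_bound)
      also have "\<dots> \<le> b * (B * (\<bar>\<epsilon>\<bar> * \<rho> \<epsilon>)) * \<Theta>"
        using w \<open>b \<ge> 0\<close> \<open>0 \<le> \<Theta>\<close> by (intro mult_right_mono mult_left_mono)
      finally show ?thesis .
    qed
    then have AE_bound: "AE \<omega> in P \<epsilon>. norm (g \<epsilon> \<omega> - \<phi>\<^sub>h \<omega> - \<epsilon> * \<phi>\<^sub>\<Gamma> \<omega>) \<le> b * (B * (\<bar>\<epsilon>\<bar> * \<rho> \<epsilon>)) * \<Theta>"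
      using AE_\<Omega>'[OF \<epsilon>(1)] by auto
    have "norm (R \<epsilon>) \<le> (\<integral>\<omega>. norm (g \<epsilon> \<omega> - \<phi>\<^sub>h \<omega> - \<epsilon> * \<phi>\<^sub>\<Gamma> \<omega>) \<partial>P \<epsilon>)"
      unfolding R_def by (rule Bochner_Integration.integral_norm_bound)
    also have "\<dots> \<le> (\<integral>\<omega>. b * (B * (\<bar>\<epsilon>\<bar> * \<rho> \<epsilon>)) * \<Theta> \<partial>P \<epsilon>)"
      using int_\<mu>(1)[OF \<epsilon>(1)] int_F[OF \<epsilon>(1) \<phi>\<^sub>h(1)] int_F[OF \<epsilon>(1) \<phi>\<^sub>\<Gamma>(1)] AE_bound
      by (intro integral_mono_AE) auto
    also have "\<dots> = b * B * \<Theta> * \<rho> \<epsilon> * \<bar>\<epsilon>\<bar>" by (simp add: prob_space mult_ac)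
    finally show ?case using \<epsilon>(2) by (simp add: field_simps)
  qed
  have "((\<lambda>\<epsilon>. \<bar>\<epsilon>\<bar> powr \<zeta>) \<longlongrightarrow> \<bar>0\<bar> powr \<zeta>) (at 0 within I)"
    using constants by (intro tendsto_powr' tendsto_rabs tendsto_ident_at tendsto_const) auto
  then have powr_lim: "((\<lambda>\<epsilon>. \<bar>\<epsilon>\<bar> powr \<zeta>) \<longlongrightarrow> 0) (at 0 within I)" by simp
  have "(\<rho> \<longlongrightarrow> 0 + sqrt 0) (at 0 within I)"
    unfolding \<rho>_def by (intro tendsto_add tendsto_real_sqrt powr_lim)
  then have "((\<lambda>\<epsilon>. b * B * \<Theta> * \<rho> \<epsilon>) \<longlongrightarrow> 0) (at 0 within I)"
    by (intro tendsto_mult_right_zero) simp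
  with R_bound have R_lim: "((\<lambda>\<epsilon>. R \<epsilon> / \<epsilon>) \<longlongrightarrow> 0) (at 0 within I)"
    by (rule Lim_null_comparison)
  have h_lim: "((\<lambda>\<epsilon>. ((\<integral>\<omega>. \<phi>\<^sub>h \<omega> \<partial>P \<epsilon>) - (\<integral>\<omega>. \<phi>\<^sub>h \<omega> \<partial>P 0)) / (\<epsilon> - 0)) \<longlongrightarrow> P' \<phi>\<^sub>h) (at 0 within I)"
    using P'[OF \<phi>\<^sub>h(1)] by (simp add: has_field_derivative_iff)
  \<comment> \<open>Since the factor \<epsilon> in front of this term is divided out, the continuity
    implied by differentiability at 0 suffices.\<close>
  have \<Gamma>_lim: "((\<lambda>\<epsilon>. \<integral>\<omega>. \<phi>\<^sub>\<Gamma> \<omega> \<partial>P \<epsilon>) \<longlongrightarrow> (\<integral>\<omega>. \<phi>\<^sub>\<Gamma> \<omega> \<partial>P 0)) (at 0 within I)"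
    using DERIV_continuous[OF P'[OF \<phi>\<^sub>\<Gamma>(1)]] by (simp add: continuous_within)
  have "((\<lambda>\<epsilon>. R \<epsilon> / \<epsilon> + (\<integral>\<omega>. \<phi>\<^sub>\<Gamma> \<omega> \<partial>P \<epsilon>)
        + ((\<integral>\<omega>. \<phi>\<^sub>h \<omega> \<partial>P \<epsilon>) - (\<integral>\<omega>. \<phi>\<^sub>h \<omega> \<partial>P 0)) / (\<epsilon> - 0))
      \<longlongrightarrow> 0 + (\<integral>\<omega>. \<phi>\<^sub>\<Gamma> \<omega> \<partial>P 0) + P' \<phi>\<^sub>h) (at 0 within I)"
    by (intro tendsto_add R_lim h_lim \<Gamma>_lim)
  moreover have "\<forall>\<^sub>F \<epsilon> in at 0 within I. R \<epsilon> / \<epsilon> + (\<integral>\<omega>. \<phi>\<^sub>\<Gamma> \<omega> \<partial>P \<epsilon>)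
        + ((\<integral>\<omega>. \<phi>\<^sub>h \<omega> \<partial>P \<epsilon>) - (\<integral>\<omega>. \<phi>\<^sub>h \<omega> \<partial>P 0)) / (\<epsilon> - 0)
      = ((\<integral>z. \<Phi> z \<partial>\<mu> \<epsilon>) - (\<integral>z. \<Phi> z \<partial>\<mu> 0)) / \<epsilon>"
    using in_I
  proof eventually_elim
    case (elim \<epsilon>)
    then have \<epsilon>: "\<epsilon> \<in> I" "\<epsilon> \<noteq> 0" by auto
    have g_split: "(\<integral>\<omega>. g \<epsilon> \<omega> \<partial>P \<epsilon>) = R \<epsilon> + (\<integral>\<omega>. \<phi>\<^sub>h \<omega> \<partial>P \<epsilon>) + \<epsilon> * (\<integral>\<omega>. \<phi>\<^sub>\<Gamma> \<omega> \<partial>P \<epsilon>)"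
      unfolding R_def using int_\<mu>(1)[OF \<epsilon>(1)] int_F[OF \<epsilon>(1) \<phi>\<^sub>h(1)] int_F[OF \<epsilon>(1) \<phi>\<^sub>\<Gamma>(1)] by simp
    show ?case
      unfolding \<mu>0 int_\<mu>(2)[OF \<epsilon>(1)] g_split
      using \<epsilon>(2) by (simp add: add_divide_distrib diff_divide_distrib)
  qed
  ultimately have "((\<lambda>\<epsilon>. ((\<integral>z. \<Phi> z \<partial>\<mu> \<epsilon>) - (\<integral>z. \<Phi> z \<partial>\<mu> 0)) / \<epsilon>)
      \<longlongrightarrow> (\<integral>\<omega>. \<phi>\<^sub>\<Gamma> \<omega> \<partial>P 0) + P' \<phi>\<^sub>h) (at 0 within I)"
    using Lim_transform_eventually by fastforce
  with summable show ?thesis by blast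
qed

end
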